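(* Let $B$ be a finite bipartite graph with $V(B)=V_0(B)\sqcup V_1(B)$, and let $A(B)$ be its bipartite algebra. With respect to the partial order on $V(B)$ in which every element of $V_1(B)$ is smaller than every element of $V_0(B)$ (and there are no other strict relations), the standard modules over $A(B)$ are $V_i=P_i$ when $i\in V_0(B)$ and $V_i=L_i$ when $i\in V_1(B)$; that is, these modules, with the canonical surjections $P_i\to V_i\to L_i$, satisfy the defining conditions of standard modules.
   Context: Let $Q(B)$ be the double quiver of $B$ (each edge replaced by two arrows, one in each orientation). The bipartite algebra $A(B)$ is the quotient of the path algebra of $Q(B)$ over $\mathbb C$ (product = concatenation, first path then second) by the ideal generated by all length-two paths which start and end in $V_0(B)$; it is $\mathbb Z$-graded by path length. Let $e_i$ be the constant path at $i$, $P_i=A(B)e_i$, and let $L_i$ be the one-dimensional simple module on which $e_i$ acts as the identity and all $e_j$, $j\ne i$, and all elements of positive degree act by zero; $P_i$ is the projective cover of $L_i$. Standard modules: for an algebra with simple left modules $\{L_i\}_{i\in I}$ and projective covers $\{P_i\}_{i\in I}$, and a partial order $<$ on $I$, a set of standard modules is a family $\{V_i\}_{i\in I}$ with surjections $P_i\xrightarrow{p_i}V_i\xrightarrow{\pi_i}L_i$ such that for all $i\in I$: (1) $\ker(\pi_i)$ has a filtration in which each subquotient is isomorphic to $L_j$ for some $j<i$; (2) $\ker(p_i)$ has a filtration in which each subquotient is isomorphic to $V_k$ for some $k>i$. (Isomorphisms of subquotients are up to grading shift.) *)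

theory Defs
  imports
    "HOL-Algebra.QuotRing"
    "HOL-Algebra.Module"
    "HOL-Library.Poly_Mapping"
    "Graph_Theory.Arc_Walk"
begin

section \<open>Graded rings and graded left modules\<close>

text \<open>
  HOL-Algebra's locale \<open>module\<close> requires a commutative ring of scalars, so left modules over an
  arbitrary ring are introduced here, on the library's module record. An algebra over a field with
  unit enters only through its underlying ring: scalars act through multiples of the unit, hence
  modules, submodules, ideals and homomorphisms are automatically linear over the field.
\<close>

record ('a, 'm) gmodule = "('a, 'm) module" +
  homog :: "int \<Rightarrow> 'm set"

definition decomposes :: "('a, 'b) ring_scheme \<Rightarrow> (int \<Rightarrow> 'a set) \<Rightarrow> 'a \<Rightarrow> (int \<Rightarrow> 'a) \<Rightarrow> bool" where
  "decomposes M D x c \<longleftrightarrow>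
     (\<forall>n. c n \<in> D n) \<and> finite {n. c n \<noteq> \<zero>\<^bsub>M\<^esub>} \<and> x = finsum M c {n. c n \<noteq> \<zero>\<^bsub>M\<^esub>}"

definition graded_group :: "('a, 'b) ring_scheme \<Rightarrow> (int \<Rightarrow> 'a set) \<Rightarrow> bool" where
  "graded_group M D \<longleftrightarrow>
     (\<forall>n. additive_subgroup (D n) M) \<and> (\<forall>x\<in>carrier M. \<exists>!c. decomposes M D x c)"

definition hpart :: "('a, 'b) ring_scheme \<Rightarrow> (int \<Rightarrow> 'a set) \<Rightarrow> int \<Rightarrow> 'a \<Rightarrow> 'a" where
  "hpart M D n x = (THE c. decomposes M D x c) n"

locale graded_ring = ring R for R (structure) +
  fixes D :: "int \<Rightarrow> 'a set"
  assumes graded: "graded_group R D"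
    and one_degree: "\<one> \<in> D 0"
    and mult_degree: "\<lbrakk>a \<in> D m; b \<in> D n\<rbrakk> \<Longrightarrow> a \<otimes> b \<in> D (m + n)"

locale left_module = R?: ring R + M?: abelian_group M
  for R :: "('a, 'b) ring_scheme" (structure) and M :: "('a, 'm, 'c) module_scheme" (structure) +
  assumes smult_closed: "\<lbrakk>a \<in> carrier R; x \<in> carrier M\<rbrakk> \<Longrightarrow> a \<odot>\<^bsub>M\<^esub> x \<in> carrier M"
    and smult_l_distr: "\<lbrakk>a \<in> carrier R; b \<in> carrier R; x \<in> carrier M\<rbrakk> \<Longrightarrow>
      (a \<oplus>\<^bsub>R\<^esub> b) \<odot>\<^bsub>M\<^esub> x = a \<odot>\<^bsub>M\<^esub> x \<oplus>\<^bsub>M\<^esub> b \<odot>\<^bsub>M\<^esub> x"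
    and smult_r_distr: "\<lbrakk>a \<in> carrier R; x \<in> carrier M; y \<in> carrier M\<rbrakk> \<Longrightarrow>
      a \<odot>\<^bsub>M\<^esub> (x \<oplus>\<^bsub>M\<^esub> y) = a \<odot>\<^bsub>M\<^esub> x \<oplus>\<^bsub>M\<^esub> a \<odot>\<^bsub>M\<^esub> y"
    and smult_assoc: "\<lbrakk>a \<in> carrier R; b \<in> carrier R; x \<in> carrier M\<rbrakk> \<Longrightarrow>
      (a \<otimes>\<^bsub>R\<^esub> b) \<odot>\<^bsub>M\<^esub> x = a \<odot>\<^bsub>M\<^esub> (b \<odot>\<^bsub>M\<^esub> x)"
    and smult_one: "x \<in> carrier M \<Longrightarrow> \<one>\<^bsub>R\<^esub> \<odot>\<^bsub>M\<^esub> x = x"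

definition graded_module ::
  "('a, 'b) ring_scheme \<Rightarrow> (int \<Rightarrow> 'a set) \<Rightarrow> ('a, 'm) gmodule \<Rightarrow> bool" where
  "graded_module R D M \<longleftrightarrow>
     left_module R M \<and> graded_group M (homog M) \<and>
     (\<forall>m n. \<forall>a\<in>D m. \<forall>x\<in>homog M n. a \<odot>\<^bsub>M\<^esub> x \<in> homog M (m + n))"

definition graded_submodule ::
  "('a, 'b) ring_scheme \<Rightarrow> ('a, 'm) gmodule \<Rightarrow> 'm set \<Rightarrow> bool" where
  "graded_submodule R M N \<longleftrightarrow>
     additive_subgroup N M \<and>
     (\<forall>a\<in>carrier R. \<forall>x\<in>N. a \<odot>\<^bsub>M\<^esub> x \<in> N) \<and>
     (\<forall>x\<in>N. \<forall>n. hpart M (homog M) n x \<in> N)"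

definition restrict_module :: "('a, 'm) gmodule \<Rightarrow> 'm set \<Rightarrow> ('a, 'm) gmodule" where
  "restrict_module M N = M\<lparr>carrier := N, homog := \<lambda>n. homog M n \<inter> N\<rparr>"

text \<open>
  The library's module record extends the ring record; its fields \<open>mult\<close> and \<open>one\<close> have no meaning
  for modules.
\<close>

definition quotient_module :: "('a, 'm) gmodule \<Rightarrow> 'm set \<Rightarrow> ('a, 'm set) gmodule" where
  "quotient_module M N =
     \<lparr>carrier = a_rcosets\<^bsub>M\<^esub> N, mult = undefined, one = undefined,
      zero = N, add = set_add M,
      smult = \<lambda>a X. \<Union>x\<in>X. N +>\<^bsub>M\<^esub> (a \<odot>\<^bsub>M\<^esub> x),
      homog = \<lambda>n. (\<lambda>x. N +>\<^bsub>M\<^esub> x) ` homog M n\<rparr>"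

definition graded_hom ::
  "('a, 'b) ring_scheme \<Rightarrow> ('a, 'm) gmodule \<Rightarrow> ('a, 'n) gmodule \<Rightarrow> ('m \<Rightarrow> 'n) \<Rightarrow> bool" where
  "graded_hom R M N f \<longleftrightarrow>
     f \<in> hom (add_monoid M) (add_monoid N) \<and>
     (\<forall>a\<in>carrier R. \<forall>x\<in>carrier M. f (a \<odot>\<^bsub>M\<^esub> x) = a \<odot>\<^bsub>N\<^esub> f x) \<and>
     (\<forall>n. f ` homog M n \<subseteq> homog N n)"

definition graded_epi ::
  "('a, 'b) ring_scheme \<Rightarrow> ('a, 'm) gmodule \<Rightarrow> ('a, 'n) gmodule \<Rightarrow> ('m \<Rightarrow> 'n) \<Rightarrow> bool" where
  "graded_epi R M N f \<longleftrightarrow> graded_hom R M N f \<and> f ` carrier M = carrier N"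

definition graded_iso ::
  "('a, 'b) ring_scheme \<Rightarrow> ('a, 'm) gmodule \<Rightarrow> ('a, 'n) gmodule \<Rightarrow> ('m \<Rightarrow> 'n) \<Rightarrow> bool" where
  "graded_iso R M N f \<longleftrightarrow>
     graded_hom R M N f \<and> bij_betw f (carrier M) (carrier N) \<and>
     (\<forall>n. f ` homog M n = homog N n)"

definition shift_module :: "int \<Rightarrow> ('a, 'm) gmodule \<Rightarrow> ('a, 'm) gmodule" where
  "shift_module d M = M\<lparr>homog := \<lambda>n. homog M (n + d)\<rparr>"

definition iso_up_to_shift ::
  "('a, 'b) ring_scheme \<Rightarrow> ('a, 'm) gmodule \<Rightarrow> ('a, 'n) gmodule \<Rightarrow> bool" where
  "iso_up_to_shift R M N \<longleftrightarrow> (\<exists>d f. graded_iso R M (shift_module d N) f)"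

definition has_filtration ::
  "('a, 'b) ring_scheme \<Rightarrow> ('a, 'm) gmodule \<Rightarrow> 'm set \<Rightarrow> ('a, 'n) gmodule set \<Rightarrow> bool" where
  "has_filtration R M K \<X> \<longleftrightarrow>
     (\<exists>r::nat. \<exists>F :: nat \<Rightarrow> 'm set.
        F 0 = {\<zero>\<^bsub>M\<^esub>} \<and> F r = K \<and>
        (\<forall>k\<le>r. graded_submodule R M (F k)) \<and>
        (\<forall>k<r. F k \<subseteq> F (Suc k) \<and>
           (\<exists>X\<in>\<X>. iso_up_to_shift R (quotient_module (restrict_module M (F (Suc k))) (F k)) X)))"


section \<open>Standard modules\<close>

text \<open>
  Everything is graded: the surjections preserve degrees, filtrations consist of graded
  submodules, and subquotients are identified up to a shift of the grading. The families \<open>L\<close>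
  (meant to be the simple modules) and \<open>P\<close> (meant to be their projective covers) are given data;
  the locale states the conditions that make \<open>V\<close>, \<open>p\<close>, \<open>\<pi>\<close> standard with respect to them.
\<close>

locale standard_modules = graded_ring R D
  for R :: "('a, 'b) ring_scheme" and D :: "int \<Rightarrow> 'a set" +
  fixes I :: "'i set"
    and less :: "'i \<Rightarrow> 'i \<Rightarrow> bool"
    and L :: "'i \<Rightarrow> ('a, 'l) gmodule"
    and P :: "'i \<Rightarrow> ('a, 'p) gmodule"
    and V :: "'i \<Rightarrow> ('a, 'v) gmodule"
    and p :: "'i \<Rightarrow> 'p \<Rightarrow> 'v"
    and \<pi> :: "'i \<Rightarrow> 'v \<Rightarrow> 'l"
  assumes order: "irreflp_on I less" "transp_on I less"
    and L_module: "i \<in> I \<Longrightarrow> graded_module R D (L i)"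
    and P_module: "i \<in> I \<Longrightarrow> graded_module R D (P i)"
    and V_module: "i \<in> I \<Longrightarrow> graded_module R D (V i)"
    and p_epi: "i \<in> I \<Longrightarrow> graded_epi R (P i) (V i) (p i)"
    and pi_epi: "i \<in> I \<Longrightarrow> graded_epi R (V i) (L i) (\<pi> i)"
    and ker_pi: "i \<in> I \<Longrightarrow>
      has_filtration R (V i) (a_kernel (V i) (L i) (\<pi> i)) (L ` {j\<in>I. less j i})"
    and ker_p: "i \<in> I \<Longrightarrow>
      has_filtration R (P i) (a_kernel (P i) (V i) (p i)) (V ` {k\<in>I. less i k})"


section \<open>Path algebras\<close>

text \<open>
  A quiver is a digraph, possibly with parallel arcs. A path is a start vertex together with a
  list of composable arcs; the constant path at \<open>v\<close> is \<open>(v, [])\<close>.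
\<close>

type_synonym ('v, 'a) path = "'v \<times> 'a list"

definition paths :: "('v, 'a) pre_digraph \<Rightarrow> ('v, 'a) path set" where
  "paths Q = {(u, s). \<exists>v. pre_digraph.awalk Q u s v}"

definition source :: "('v, 'a) path \<Rightarrow> 'v" where
  "source p = fst p"

definition target :: "('v, 'a) pre_digraph \<Rightarrow> ('v, 'a) path \<Rightarrow> 'v" where
  "target Q p = pre_digraph.awlast Q (fst p) (snd p)"

definition path_length :: "('v, 'a) path \<Rightarrow> nat" where
  "path_length p = length (snd p)"

text \<open>In the product of two paths the left factor is traversed first.\<close>

definition path_mult :: "('v, 'a) pre_digraph \<Rightarrow>
    (('v, 'a) path \<Rightarrow>\<^sub>0 complex) \<Rightarrow> (('v, 'a) path \<Rightarrow>\<^sub>0 complex) \<Rightarrow> (('v, 'a) path \<Rightarrow>\<^sub>0 complex)" where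
  "path_mult Q f g =
     (\<Sum>p\<in>Poly_Mapping.keys f. \<Sum>q\<in>Poly_Mapping.keys g.
        if target Q p = source q
        then Poly_Mapping.single (source p, snd p @ snd q)
               (Poly_Mapping.lookup f p * Poly_Mapping.lookup g q)
        else 0)"

definition path_algebra :: "('v, 'a) pre_digraph \<Rightarrow> (('v, 'a) path \<Rightarrow>\<^sub>0 complex) ring" where
  "path_algebra Q =
     \<lparr>carrier = {f. Poly_Mapping.keys f \<subseteq> paths Q},
      mult = path_mult Q,
      one = (\<Sum>v\<in>verts Q. Poly_Mapping.single (v, []) 1),
      zero = 0, add = (+)\<rparr>"


section \<open>Bipartite graphs and their algebras\<close>

text \<open>
  Parallel edges are allowed. A simple graph is the case in which \<open>e \<mapsto> (end0 B e, end1 B e)\<close> is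
  injective on the edges.
\<close>

record ('v, 'e) bigraph =
  part0 :: "'v set"
  part1 :: "'v set"
  edges :: "'e set"
  end0 :: "'e \<Rightarrow> 'v"
  end1 :: "'e \<Rightarrow> 'v"

locale finite_bipartite_graph =
  fixes B :: "('v, 'e) bigraph"
  assumes finite_part0: "finite (part0 B)"
    and finite_part1: "finite (part1 B)"
    and finite_edges: "finite (edges B)"
    and parts_disjoint: "part0 B \<inter> part1 B = {}"
    and end0_in: "e \<in> edges B \<Longrightarrow> end0 B e \<in> part0 B"
    and end1_in: "e \<in> edges B \<Longrightarrow> end1 B e \<in> part1 B"

definition vertices :: "('v, 'e) bigraph \<Rightarrow> 'v set" where
  "vertices B = part0 B \<union> part1 B"

text \<open>
  The arrow \<open>(e, True)\<close> runs along \<open>e\<close> from \<open>end0\<close> to \<open>end1\<close>, the arrow \<open>(e, False)\<close> back.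
\<close>

definition double_quiver :: "('v, 'e) bigraph \<Rightarrow> ('v, 'e \<times> bool) pre_digraph" where
  "double_quiver B =
     \<lparr>verts = vertices B, arcs = edges B \<times> UNIV,
      tail = \<lambda>(e, b). if b then end0 B e else end1 B e,
      head = \<lambda>(e, b). if b then end1 B e else end0 B e\<rparr>"

type_synonym ('v, 'e) path_elt = "('v, 'e \<times> bool) path \<Rightarrow>\<^sub>0 complex"

definition bip_ideal :: "('v, 'e) bigraph \<Rightarrow> ('v, 'e) path_elt set" where
  "bip_ideal B =
     genideal (path_algebra (double_quiver B))
       {Poly_Mapping.single p 1 | p. p \<in> paths (double_quiver B) \<and> path_length p = 2 \<and>
          source p \<in> part0 B \<and> target (double_quiver B) p \<in> part0 B}"

definition bip_class :: "('v, 'e) bigraph \<Rightarrow> ('v, 'e) path_elt \<Rightarrow> ('v, 'e) path_elt set" where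
  "bip_class B f = bip_ideal B +>\<^bsub>path_algebra (double_quiver B)\<^esub> f"

definition bip_alg :: "('v, 'e) bigraph \<Rightarrow> ('v, 'e) path_elt set ring" where
  "bip_alg B = path_algebra (double_quiver B) Quot bip_ideal B"

definition bip_deg :: "('v, 'e) bigraph \<Rightarrow> int \<Rightarrow> ('v, 'e) path_elt set set" where
  "bip_deg B n =
     bip_class B ` {f \<in> carrier (path_algebra (double_quiver B)).
       \<forall>p\<in>Poly_Mapping.keys f. int (path_length p) = n}"

definition bip_idem :: "('v, 'e) bigraph \<Rightarrow> 'v \<Rightarrow> ('v, 'e) path_elt set" where
  "bip_idem B i = bip_class B (Poly_Mapping.single (i, []) 1)"

definition bip_P ::
  "('v, 'e) bigraph \<Rightarrow> 'v \<Rightarrow> (('v, 'e) path_elt set, ('v, 'e) path_elt set) gmodule" where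
  "bip_P B i =
     (let A = bip_alg B; C = {a \<otimes>\<^bsub>A\<^esub> bip_idem B i | a. a \<in> carrier A} in
     \<lparr>carrier = C, mult = undefined, one = undefined, zero = \<zero>\<^bsub>A\<^esub>, add = add A,
      smult = mult A, homog = \<lambda>n. bip_deg B n \<inter> C\<rparr>)"

text \<open>
  The degree zero part of the algebra is spanned by the idempotents \<open>e\<^sub>j\<close>, so its multiples of
  \<open>e\<^sub>i\<close> form the line spanned by \<open>e\<^sub>i\<close>. This line carries the simple module \<open>L\<^sub>i\<close>: an element \<open>a\<close>
  acts as multiplication by its degree zero part, so \<open>e\<^sub>i\<close> acts as the identity while the other
  \<open>e\<^sub>j\<close> and all elements of positive degree act by zero.
\<close>

definition bip_L ::
  "('v, 'e) bigraph \<Rightarrow> 'v \<Rightarrow> (('v, 'e) path_elt set, ('v, 'e) path_elt set) gmodule" where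
  "bip_L B i =
     (let A = bip_alg B; C = {a \<otimes>\<^bsub>A\<^esub> bip_idem B i | a. a \<in> bip_deg B 0} in
     \<lparr>carrier = C, mult = undefined, one = undefined, zero = \<zero>\<^bsub>A\<^esub>, add = add A,
      smult = \<lambda>a x. hpart A (bip_deg B) 0 a \<otimes>\<^bsub>A\<^esub> x,
      homog = \<lambda>n. if n = 0 then C else {\<zero>\<^bsub>A\<^esub>}\<rparr>)"

text \<open>The canonical surjection from \<open>P\<^sub>i\<close> to \<open>L\<^sub>i\<close>; it sends \<open>e\<^sub>i\<close> to \<open>e\<^sub>i\<close>.\<close>

definition bip_top :: "('v, 'e) bigraph \<Rightarrow> ('v, 'e) path_elt set \<Rightarrow> ('v, 'e) path_elt set" where
  "bip_top B = hpart (bip_alg B) (bip_deg B) 0"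

end

theory Submission
  imports Defs
begin

text \<open>
  In the double quiver every arrow changes sides. A path from \<open>V\<^sub>0\<close> to \<open>V\<^sub>1\<close> and back to \<open>V\<^sub>0\<close> is zero
  in the algebra, and nothing else is identified, so the classes of the paths that do not contain
  such a detour form a basis. These \<^emph>\<open>normal paths\<close> are the constant paths, the single
  arrows, and the paths of length two that start and end in \<open>V\<^sub>1\<close>. Everything is computed in this
  basis: the ideal is the set of combinations of paths that are not normal (\<open>bip_ideal_eq\<close>), \<open>P\<^sub>i\<close> has
  the normal paths ending at \<open>i\<close> as a basis, and \<open>L\<^sub>i\<close> has the constant path at \<open>i\<close>.

  The kernel of \<open>P\<^sub>i \<rightarrow> L\<^sub>i\<close> is spanned by the nonconstant normal paths ending at \<open>i\<close>. Left
  multiplication does not change the last arrow of such a path, hence the kernel is the direct sum of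
  the submodules \<open>Aa\<close>, where \<open>a\<close> runs through the arrows with head \<open>i\<close>. Let \<open>j\<close> be the tail of \<open>a\<close>.
  Right multiplication by \<open>a\<close> maps the normal paths \<open>p\<close> ending at \<open>j\<close> for which \<open>pa\<close> is still normal
  bijectively onto the basis of \<open>Aa\<close> (\<open>ending_in_eq\<close>), and there are two cases:

  \<^item> If \<open>i\<close> lies in \<open>V\<^sub>0\<close>, then \<open>j\<close> lies in \<open>V\<^sub>1\<close>, and a nonconstant \<open>p\<close> would create a detour through
    \<open>V\<^sub>1\<close>. Only the constant path is left, and \<open>Aa\<close> is a copy of \<open>L\<^sub>j\<close>.
  \<^item> If \<open>i\<close> lies in \<open>V\<^sub>1\<close>, then \<open>j\<close> lies in \<open>V\<^sub>0\<close>, no such detour arises, and \<open>Aa\<close> is a copy of \<open>P\<^sub>j\<close>.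

  In both cases \<open>Aa\<close> is \<open>V\<^sub>j\<close> with its grading shifted by one, so adding one arrow at a time filters the
  kernel by standard modules (\<open>filtration_step\<close>, \<open>filtration_kernel_top\<close>), and \<open>j\<close> lies on the side
  that the order requires. This one filtration serves \<open>ker \<pi>\<^sub>i\<close> for \<open>i\<close> in \<open>V\<^sub>0\<close> and \<open>ker p\<^sub>i\<close> for \<open>i\<close> in
  \<open>V\<^sub>1\<close>; the other two kernels are zero.
\<close>

section \<open>Finitely supported functions\<close>

abbreviation supp :: "('p \<Rightarrow>\<^sub>0 'c::zero) \<Rightarrow> 'p set" where
  "supp \<equiv> Poly_Mapping.keys"

abbreviation coeff :: "('p \<Rightarrow>\<^sub>0 'c::zero) \<Rightarrow> 'p \<Rightarrow> 'c" where
  "coeff \<equiv> Poly_Mapping.lookup"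

abbreviation single :: "'p \<Rightarrow> 'c \<Rightarrow> 'p \<Rightarrow>\<^sub>0 'c::zero" where
  "single \<equiv> Poly_Mapping.single"

lift_definition restr :: "'p set \<Rightarrow> ('p \<Rightarrow>\<^sub>0 'c::zero) \<Rightarrow> 'p \<Rightarrow>\<^sub>0 'c"
  is "\<lambda>K f p. if p \<in> K then f p else 0"
  by (rule finite_subset) auto

lemma coeff_restr [simp]: "coeff (restr K f) p = (if p \<in> K then coeff f p else 0)"
  by transfer simp

lemma supp_restr: "supp (restr K f) = supp f \<inter> K"
  by (auto simp: in_keys_iff split: if_splits)

lemma restr_add: "restr K (f + g) = restr K f + restr K (g :: 'p \<Rightarrow>\<^sub>0 'c::monoid_add)"
  by (rule poly_mapping_eqI) (simp add: lookup_add)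

lemma restr_add_compl: "restr K f + restr (- K) f = (f :: 'p \<Rightarrow>\<^sub>0 'c::monoid_add)"
  by (rule poly_mapping_eqI) (simp add: lookup_add)

lemma restr_idle: "supp f \<subseteq> K \<Longrightarrow> restr K f = f"
  by (rule poly_mapping_eqI) (auto simp: in_keys_iff)

lemma restr_eq_0: "supp f \<inter> K = {} \<Longrightarrow> restr K f = 0"
  by (rule poly_mapping_eqI) (auto simp: in_keys_iff)

lemma supp_disjoint_iff: "supp f \<inter> K = {} \<longleftrightarrow> (\<forall>p\<in>K. coeff f p = 0)"
  by (meson disjoint_iff in_keys_iff)

lemma supp_sum: "supp (sum h X) \<subseteq> (\<Union>x\<in>X. supp (h x))"
proof (induction X rule: infinite_finite_induct)
  case (insert x X)
  then show ?case using keys_add[of "h x" "sum h X"] by auto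
qed auto

lemma supp_add: "supp f \<subseteq> K \<Longrightarrow> supp g \<subseteq> K \<Longrightarrow> supp (f + g) \<subseteq> K"
  using keys_add[of f g] by blast

lemma coeff_sum_single:
  "finite X \<Longrightarrow> coeff (\<Sum>x\<in>X. single x (c x)) p = (if p \<in> X then c p else 0)"
  by (simp add: lookup_sum lookup_single when_def)

lemma eq_sum_single:
  "finite X \<Longrightarrow> supp f \<subseteq> X \<Longrightarrow> f = (\<Sum>x\<in>X. single x (coeff f x))"
  by (rule poly_mapping_eqI) (auto simp: coeff_sum_single in_keys_iff)

text \<open>
  Additive statements about finitely supported functions reduce to functions supported at one
  point. The laws of the path algebra are reduced to single paths in this way.
\<close>

lemma supp_additive_induct [consumes 1, case_names zero add single]:
  fixes f :: "'p \<Rightarrow>\<^sub>0 'c::comm_monoid_add"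
  assumes "supp f \<subseteq> K" and "P 0"
    and "\<And>f g. P f \<Longrightarrow> P g \<Longrightarrow> P (f + g)"
    and "\<And>p c. p \<in> K \<Longrightarrow> P (single p c)"
  shows "P f"
proof -
  have "P (\<Sum>p\<in>X. single p (coeff f p))" if "finite X" "X \<subseteq> K" for X
    using that by (induction X rule: finite_induct) (auto intro: assms)
  from this[OF finite_keys assms(1)] show ?thesis
    using eq_sum_single[of "supp f" f] by simp
qed


section \<open>The path algebra is a ring\<close>

definition path_append :: "('v, 'a) path \<Rightarrow> ('v, 'a) path \<Rightarrow> ('v, 'a) path" where
  "path_append p q = (source p, snd p @ snd q)"

lemma target_Nil [simp]: "target Q (u, []) = u"
  by (simp add: target_def pre_digraph.awalk_verts.simps)

lemma target_Cons [simp]: "target Q (u, a # s) = target Q (head Q a, s)"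
  by (cases s) (simp_all add: target_def pre_digraph.awalk_verts.simps)

lemma target_snoc [simp]: "target Q (u, s @ [a]) = head Q a"
  by (induction s arbitrary: u) auto

lemma target_eq: "target Q p = (if snd p = [] then fst p else head Q (last (snd p)))"
  by (cases p; cases "snd p" rule: rev_cases) auto

lemma source_append [simp]: "source (path_append p q) = source p"
  by (simp add: path_append_def source_def)

lemma target_append: "target Q p = source q \<Longrightarrow> target Q (path_append p q) = target Q q"
  by (auto simp: target_eq path_append_def source_def)

lemma path_append_assoc: "path_append (path_append p q) r = path_append p (path_append q r)"
  by (simp add: path_append_def source_def)

lemma path_length_append [simp]: "path_length (path_append p q) = path_length p + path_length q"
  by (simp add: path_length_def path_append_def)

text \<open>
  The product is defined by sums over the supports of its factors. Summing over any larger finite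
  sets instead lets two products with different supports be added termwise, which gives bilinearity.
\<close>

lemma path_mult_on:
  assumes "finite X" "supp f \<subseteq> X" "finite Y" "supp g \<subseteq> Y"
  shows "path_mult Q f g = (\<Sum>p\<in>X. \<Sum>q\<in>Y.
     if target Q p = source q then single (path_append p q) (coeff f p * coeff g q) else 0)"
proof -
  have "path_mult Q f g = (\<Sum>p\<in>supp f. \<Sum>q\<in>Y.
     if target Q p = source q then single (path_append p q) (coeff f p * coeff g q) else 0)"
    unfolding path_mult_def path_append_def 
    by (rule sum.cong[OF refl], rule sum.mono_neutral_left)
      (use assms in \<open>auto simp: in_keys_iff\<close>)
  also have "\<dots> = (\<Sum>p\<in>X. \<Sum>q\<in>Y.
     if target Q p = source q then single (path_append p q) (coeff f p * coeff g q) else 0)"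
    by (rule sum.mono_neutral_left) (use assms in \<open>auto simp: in_keys_iff intro!: sum.neutral\<close>)
  finally show ?thesis .
qed

lemma path_mult_single:
  "path_mult Q (single p c) (single q d) =
     (if target Q p = source q then single (path_append p q) (c * d) else 0)"
  by (subst path_mult_on[where X = "{p}" and Y = "{q}"]) auto

lemma path_mult_add_left: "path_mult Q (f + g) h = path_mult Q f h + path_mult Q g h"
proof -
  let ?X = "supp f \<union> supp g"
  let ?t = "\<lambda>f p q. if target Q p = source q
    then single (path_append p q) (coeff f p * coeff h q) else 0"
  have on: "path_mult Q k h = (\<Sum>p\<in>?X. \<Sum>q\<in>supp h. ?t k p q)" if "supp k \<subseteq> ?X" for k
    using that by (intro path_mult_on) auto
  have "?t (f + g) p q = ?t f p q + ?t g p q" for p q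
    by (simp add: lookup_add distrib_right single_add)
  then show ?thesis
    by (simp add: on keys_add sum.distrib)
qed

lemma path_mult_add_right: "path_mult Q h (f + g) = path_mult Q h f + path_mult Q h g"
proof -
  let ?X = "supp f \<union> supp g"
  let ?t = "\<lambda>f p q. if target Q p = source q
    then single (path_append p q) (coeff h p * coeff f q) else 0"
  have on: "path_mult Q h k = (\<Sum>p\<in>supp h. \<Sum>q\<in>?X. ?t k p q)" if "supp k \<subseteq> ?X" for k
    using that by (intro path_mult_on) auto
  have "?t (f + g) p q = ?t f p q + ?t g p q" for p q
    by (simp add: lookup_add distrib_left single_add)
  then show ?thesis
    by (simp add: on keys_add sum.distrib)
qed

lemma path_mult_restr_left:
  "path_mult Q f g = path_mult Q (restr K f) g + path_mult Q (restr (- K) f) g"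
  by (simp add: restr_add_compl flip: path_mult_add_left)

lemma path_mult_restr_right:
  "path_mult Q f g = path_mult Q f (restr K g) + path_mult Q f (restr (- K) g)"
  by (simp add: restr_add_compl flip: path_mult_add_right)

lemma path_mult_0 [simp]: "path_mult Q 0 f = 0" "path_mult Q f 0 = 0"
  by (simp_all add: path_mult_def)

lemma path_mult_sum_left: "path_mult Q (sum h X) g = (\<Sum>x\<in>X. path_mult Q (h x) g)"
  by (induction X rule: infinite_finite_induct) (auto simp: path_mult_add_left)

lemma supp_path_mult:
  "supp (path_mult Q f g) \<subseteq>
     {path_append p q | p q. p \<in> supp f \<and> q \<in> supp g \<and> target Q p = source q}"
  unfolding path_mult_def path_append_def
  by (rule subset_trans[OF supp_sum] UN_least)+ (fastforce split: if_splits)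

text \<open>
  By bilinearity only single paths matter, and there both sides concatenate the same three paths
  under the same two conditions, because the target of a concatenation is the target of its last
  factor.
\<close>

lemma path_mult_assoc: "path_mult Q (path_mult Q f g) h = path_mult Q f (path_mult Q g h)"
  using subset_UNIV[of "supp f"]
proof (induction f rule: supp_additive_induct)
  case (single p c)
  show ?case
    using subset_UNIV[of "supp g"]
  proof (induction g rule: supp_additive_induct)
    case (single q d)
    show ?case
      using subset_UNIV[of "supp h"]
      by (induction h rule: supp_additive_induct)
        (auto simp: path_mult_add_left path_mult_add_right path_mult_single target_append
          path_append_assoc mult.assoc)
  qed (simp_all add: path_mult_add_left path_mult_add_right)
qed (simp_all add: path_mult_add_left path_mult_add_right)

lemma (in wf_digraph) paths_Nil [simp]: "(u, []) \<in> paths G \<longleftrightarrow> u \<in> verts G"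
  by (auto simp: paths_def awalk_Nil_iff)

lemma (in wf_digraph) paths_Cons:
  "(u, a # s) \<in> paths G \<longleftrightarrow> a \<in> arcs G \<and> tail G a = u \<and> (head G a, s) \<in> paths G"
  by (auto simp: paths_def awalk_Cons_iff)

lemma (in wf_digraph) target_prefix:
  "(u, s @ [a]) \<in> paths G \<Longrightarrow> target G (u, s) = tail G a"
  by (auto simp: paths_def target_def awalk_Cons_iff)

lemma (in wf_digraph) paths_append:
  assumes "target G p = source q"
  shows "path_append p q \<in> paths G \<longleftrightarrow> p \<in> paths G \<and> q \<in> paths G"
  using assms by (cases p; cases q) (auto simp: paths_def path_append_def source_def target_def)

lemma (in wf_digraph) source_in_verts: "p \<in> paths G \<Longrightarrow> source p \<in> verts G"
  by (cases p) (auto simp: paths_def source_def)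

lemma (in wf_digraph) target_in_verts: "p \<in> paths G \<Longrightarrow> target G p \<in> verts G"
  by (cases p) (auto simp: paths_def target_def)

lemma path_mult_one_left:
  assumes "finite (verts Q)" "source ` supp f \<subseteq> verts Q"
  shows "path_mult Q (\<Sum>v\<in>verts Q. single (v, []) 1) f = f"
proof -
  have "supp f \<subseteq> {p. source p \<in> verts Q}" using assms(2) by auto
  then show ?thesis
  proof (induction f rule: supp_additive_induct)
    case (single p c)
    then have "path_append (source p, []) p = p"
      by (cases p) (simp add: path_append_def source_def)
    with single assms(1) show ?case
      by (simp add: path_mult_sum_left path_mult_single if_distrib cong: if_cong)
  qed (simp_all add: path_mult_add_right)
qed

lemma path_mult_sum_right: "path_mult Q g (sum h X) = (\<Sum>x\<in>X. path_mult Q g (h x))"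
  by (induction X rule: infinite_finite_induct) (auto simp: path_mult_add_right)

lemma path_mult_one_right:
  assumes "finite (verts Q)" "target Q ` supp f \<subseteq> verts Q"
  shows "path_mult Q f (\<Sum>v\<in>verts Q. single (v, []) 1) = f"
proof -
  have "supp f \<subseteq> {p. target Q p \<in> verts Q}" using assms(2) by auto
  then show ?thesis
  proof (induction f rule: supp_additive_induct)
    case (single p c)
    have "path_append p (v, []) = p" for v
      by (cases p) (simp add: path_append_def source_def)
    with single assms(1) show ?case
      by (simp add: path_mult_sum_right path_mult_single source_def if_distrib cong: if_cong)
  qed (simp_all add: path_mult_add_left)
qed

lemma (in wf_digraph) path_mult_closed:
  assumes "supp f \<subseteq> paths G" "supp g \<subseteq> paths G"
  shows "supp (path_mult G f g) \<subseteq> paths G"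
  using supp_path_mult[of G f g] assms paths_append by blast

lemma (in wf_digraph) path_algebra_ring:
  assumes "finite (verts G)"
  shows "ring (path_algebra G)"
proof (rule ringI)
  show "abelian_group (path_algebra G)"
  proof (rule abelian_groupI)
    fix f assume "f \<in> carrier (path_algebra G)"
    then show "\<exists>g\<in>carrier (path_algebra G). g \<oplus>\<^bsub>path_algebra G\<^esub> f = \<zero>\<^bsub>path_algebra G\<^esub>"
      by (intro bexI[of _ "- f"]) (auto simp: path_algebra_def in_keys_iff)
  qed (simp_all add: path_algebra_def supp_add add_ac)
  have one: "supp (\<Sum>v\<in>verts G. single (v, []) (1::complex)) \<subseteq> paths G"
    by (rule subset_trans[OF supp_sum]) (auto simp: source_in_verts)
  show "Group.monoid (path_algebra G)"
  proof (rule monoidI)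
    fix f g assume "f \<in> carrier (path_algebra G)" "g \<in> carrier (path_algebra G)"
    then show "f \<otimes>\<^bsub>path_algebra G\<^esub> g \<in> carrier (path_algebra G)"
      using path_mult_closed by (simp add: path_algebra_def)
  next
    fix f assume "f \<in> carrier (path_algebra G)"
    then show "\<one>\<^bsub>path_algebra G\<^esub> \<otimes>\<^bsub>path_algebra G\<^esub> f = f" "f \<otimes>\<^bsub>path_algebra G\<^esub> \<one>\<^bsub>path_algebra G\<^esub> = f"
      using assms source_in_verts target_in_verts
      by (auto simp: path_algebra_def intro!: path_mult_one_left path_mult_one_right)
  qed (use one in \<open>simp_all add: path_algebra_def path_mult_assoc\<close>)
qed (simp_all add: path_algebra_def path_mult_add_left path_mult_add_right)

section \<open>Groups with a graded basis\<close>

text \<open>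
  A group that is the bijective additive image of the functions supported in \<open>K\<close>, and that is graded by
  a degree \<open>d\<close> on the basis \<open>K\<close>. Homogeneous parts are then restrictions of the support. The
  algebra and all its modules below are instances, with normal paths as basis and path length
  as degree.
\<close>

locale graded_span =
  fixes M :: "('m, 'x) ring_scheme" (structure)
    and D :: "int \<Rightarrow> 'm set"
    and \<phi> :: "('p \<Rightarrow>\<^sub>0 'c::ab_group_add) \<Rightarrow> 'm"
    and K :: "'p set"
    and d :: "'p \<Rightarrow> int"
  assumes carrier_eq: "carrier M = \<phi> ` {f. supp f \<subseteq> K}"
    and inj: "inj_on \<phi> {f. supp f \<subseteq> K}"
    and zero_eq: "\<zero> = \<phi> 0"
    and add_eq: "\<lbrakk>supp f \<subseteq> K; supp g \<subseteq> K\<rbrakk> \<Longrightarrow> \<phi> f \<oplus> \<phi> g = \<phi> (f + g)"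
    and homog_eq: "D n = \<phi> ` {f. supp f \<subseteq> K \<inter> {p. d p = n}}"
begin

lemma phi_eq_iff: "supp f \<subseteq> K \<Longrightarrow> supp g \<subseteq> K \<Longrightarrow> \<phi> f = \<phi> g \<longleftrightarrow> f = g"
  using inj by (auto simp: inj_on_def)

lemma phi_eq_0_iff: "supp f \<subseteq> K \<Longrightarrow> \<phi> f = \<zero> \<longleftrightarrow> f = 0"
  by (simp add: zero_eq phi_eq_iff)

lemma phi_closed: "supp f \<subseteq> K \<Longrightarrow> \<phi> f \<in> carrier M"
  by (auto simp: carrier_eq)

lemma carrierE:
  assumes "x \<in> carrier M"
  obtains f where "supp f \<subseteq> K" "x = \<phi> f"
  using assms by (auto simp: carrier_eq)

lemma is_abelian_group: "abelian_group M"
proof (rule abelian_groupI)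
  fix x assume "x \<in> carrier M"
  then obtain f where f: "supp f \<subseteq> K" "x = \<phi> f" by (rule carrierE)
  then have "supp (- f) \<subseteq> K" by (auto simp: in_keys_iff)
  with f show "\<exists>y\<in>carrier M. y \<oplus> x = \<zero>"
    by (intro bexI[of _ "\<phi> (- f)"]) (simp_all add: add_eq zero_eq phi_closed)
next
  fix x y assume "x \<in> carrier M" "y \<in> carrier M"
  then obtain f g where "supp f \<subseteq> K" "x = \<phi> f" "supp g \<subseteq> K" "y = \<phi> g"
    by (elim carrierE)
  then show "x \<oplus> y \<in> carrier M" "x \<oplus> y = y \<oplus> x"
    by (simp_all add: add_eq phi_closed supp_add Groups.add.commute[of f g])
next
  fix x y z assume "x \<in> carrier M" "y \<in> carrier M" "z \<in> carrier M"
  then obtain f g h where "supp f \<subseteq> K" "x = \<phi> f" "supp g \<subseteq> K" "y = \<phi> g"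
    "supp h \<subseteq> K" "z = \<phi> h"
    by (elim carrierE)
  then show "x \<oplus> y \<oplus> z = x \<oplus> (y \<oplus> z)"
    by (simp add: add_eq supp_add Groups.add.assoc)
next
  show "\<zero> \<in> carrier M" by (simp add: zero_eq phi_closed)
  fix x assume "x \<in> carrier M"
  then show "\<zero> \<oplus> x = x" by (auto elim!: carrierE simp: add_eq zero_eq)
qed

lemma span_subgroup:
  assumes "K' \<subseteq> K"
  shows "additive_subgroup (\<phi> ` {f. supp f \<subseteq> K'}) M"
proof -
  interpret abelian_group M by (rule is_abelian_group)
  have inv: "a_inv M (\<phi> f) = \<phi> (- f)" if "supp f \<subseteq> K'" for f
    using that assms
    by (intro minus_equality) (auto simp: add_eq zero_eq in_keys_iff intro!: phi_closed)
  show ?thesis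
  proof (intro additive_subgroupI add.subgroupI)
    fix x assume "x \<in> \<phi> ` {f. supp f \<subseteq> K'}"
    then obtain f where f: "supp f \<subseteq> K'" "x = \<phi> f" by auto
    then have "supp (- f) \<subseteq> K'" by (auto simp: in_keys_iff)
    then show "a_inv M x \<in> \<phi> ` {f. supp f \<subseteq> K'}" using f inv by auto
  next
    fix x y assume "x \<in> \<phi> ` {f. supp f \<subseteq> K'}" "y \<in> \<phi> ` {f. supp f \<subseteq> K'}"
    then obtain f g where fg: "supp f \<subseteq> K'" "x = \<phi> f" "supp g \<subseteq> K'" "y = \<phi> g" by auto
    then have "x \<oplus> y = \<phi> (f + g)" using assms by (simp add: add_eq)
    then show "x \<oplus> y \<in> \<phi> ` {f. supp f \<subseteq> K'}" using fg supp_add by blast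
  next
    show "\<phi> ` {f. supp f \<subseteq> K'} \<subseteq> carrier M" using assms by (auto intro!: phi_closed)
    show "\<phi> ` {f. supp f \<subseteq> K'} \<noteq> {}" by (auto intro!: exI[of _ 0])
  qed
qed

lemma finsum_phi:
  assumes "finite S" "\<And>n. n \<in> S \<Longrightarrow> supp (h n) \<subseteq> K"
  shows "finsum M (\<lambda>n. \<phi> (h n)) S = \<phi> (\<Sum>n\<in>S. h n)"
  using assms
proof (induction S rule: finite_induct)
  case empty
  interpret abelian_group M by (rule is_abelian_group)
  show ?case by (simp add: zero_eq)
next
  case (insert n S)
  interpret abelian_group M by (rule is_abelian_group)
  have "supp (\<Sum>n\<in>S. h n) \<subseteq> K"
    by (rule subset_trans[OF supp_sum]) (use insert.prems in auto)
  moreover have "supp (h m) \<subseteq> K" if "m = n \<or> m \<in> S" for m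
    using that insert.prems by auto
  ultimately show ?case
    using insert by (subst finsum_insert) (auto intro!: phi_closed simp: add_eq)
qed

text \<open>
  Uniqueness holds because a decomposition of \<open>\<phi> f\<close> pulls back along the injective \<open>\<phi>\<close> to a decomposition
  of \<open>f\<close> into functions with pairwise disjoint supports, and these must be the restrictions of \<open>f\<close>.
\<close>

lemma decomposes_iff:
  assumes f: "supp f \<subseteq> K"
  shows "decomposes M D (\<phi> f) c \<longleftrightarrow> c = (\<lambda>n. \<phi> (restr {p. d p = n} f))"
proof
  assume dec: "decomposes M D (\<phi> f) c"
  then have "\<forall>n. \<exists>h. supp h \<subseteq> K \<inter> {p. d p = n} \<and> c n = \<phi> h"
    unfolding decomposes_def homog_eq image_iff by (metis mem_Collect_eq)
  then obtain h where h: "\<And>n. supp (h n) \<subseteq> K \<inter> {p. d p = n}" "\<And>n. c n = \<phi> (h n)"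
    by metis
  define S where "S = {n. h n \<noteq> 0}"
  have S: "S = {n. c n \<noteq> \<zero>}"
    using h by (auto simp: S_def phi_eq_0_iff)
  have "c = (\<lambda>n. \<phi> (h n))" using h(2) by auto
  then have "\<phi> f = finsum M (\<lambda>n. \<phi> (h n)) S" and fin: "finite S"
    using dec by (simp_all add: decomposes_def S)
  then have "\<phi> f = \<phi> (\<Sum>n\<in>S. h n)"
    using h by (simp add: finsum_phi)
  moreover have "supp (\<Sum>n\<in>S. h n) \<subseteq> K"
    by (rule subset_trans[OF supp_sum]) (use h(1) in auto)
  ultimately have f_eq: "f = (\<Sum>n\<in>S. h n)"
    using f phi_eq_iff by blast
  have zero: "coeff (h m) p = 0" if "m \<noteq> d p" for m p
    using h(1)[of m] that by (auto simp: in_keys_iff)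
  have "restr {p. d p = n} f = h n" for n
  proof (rule poly_mapping_eqI)
    fix p
    have "coeff f p = (\<Sum>m\<in>S. if d p = m then coeff (h m) p else 0)"
      unfolding f_eq lookup_sum by (rule sum.cong) (use zero in auto)
    also have "\<dots> = coeff (h (d p)) p"
      using fin by (simp add: S_def)
    finally show "coeff (restr {p. d p = n} f) p = coeff (h n) p"
      using zero by auto
  qed
  with h(2) show "c = (\<lambda>n. \<phi> (restr {p. d p = n} f))" by auto
next
  assume c: "c = (\<lambda>n. \<phi> (restr {p. d p = n} f))"
  have supp: "supp (restr {p. d p = n} f) \<subseteq> K" for n
    using f by (auto simp: supp_restr)
  define S where "S = {n. restr {p. d p = n} f \<noteq> 0}"
  have S: "S = {n. c n \<noteq> \<zero>}"
    using supp by (simp add: S_def c phi_eq_0_iff)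
  have "S \<subseteq> d ` supp f"
  proof
    fix n assume "n \<in> S"
    then have "supp f \<inter> {p. d p = n} \<noteq> {}" using restr_eq_0 by (auto simp: S_def)
    then show "n \<in> d ` supp f" by auto
  qed
  then have fin: "finite S" by (rule finite_subset) simp
  have "(\<Sum>n\<in>S. restr {p. d p = n} f) = f"
  proof (rule poly_mapping_eqI)
    fix p
    have "d p \<in> S" if "coeff f p \<noteq> 0"
    proof -
      have "restr {q. d q = d p} f \<noteq> 0"
        using that by (metis (mono_tags) coeff_restr lookup_zero mem_Collect_eq)
      then show ?thesis by (simp add: S_def)
    qed
    then show "coeff (\<Sum>n\<in>S. restr {p. d p = n} f) p = coeff f p"
      using fin by (auto simp: lookup_sum)
  qed
  moreover have "finsum M c S = \<phi> (\<Sum>n\<in>S. restr {p. d p = n} f)"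
    unfolding c by (rule finsum_phi[OF fin supp])
  moreover have "c n \<in> D n" for n
    unfolding homog_eq c using f by (intro imageI) (auto simp: supp_restr)
  ultimately show "decomposes M D (\<phi> f) c"
    using fin by (simp add: decomposes_def flip: S)
qed

lemma is_graded_group: "graded_group M D"
  unfolding graded_group_def
proof (intro conjI allI ballI)
  show "additive_subgroup (D n) M" for n
    unfolding homog_eq by (rule span_subgroup) simp
  show "\<exists>!c. decomposes M D x c" if "x \<in> carrier M" for x
    using that by (elim carrierE) (simp add: decomposes_iff)
qed

lemma hpart_phi: "supp f \<subseteq> K \<Longrightarrow> hpart M D n (\<phi> f) = \<phi> (restr {p. d p = n} f)"
  by (simp add: hpart_def decomposes_iff)

end


section \<open>Quotients of left modules and filtrations\<close>

text \<open>
  If a homomorphism \<open>g\<close> embeds \<open>X\<close> in \<open>M\<close> as a complement of the submodule \<open>N\<close>, then \<open>X\<close> represents the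
  quotient: \<open>x \<mapsto> N + g x\<close> is bijective, and its inverse is the isomorphism. The complement has to
  be taken degree by degree, since otherwise the homogeneous parts of the quotient could be larger
  than the images of those of \<open>X\<close>.
\<close>

lemma quotient_by_complement:
  assumes M: "left_module R M" and X: "left_module R X"
    and N: "additive_subgroup N M"
    and N_smult: "\<And>a x. \<lbrakk>a \<in> carrier R; x \<in> N\<rbrakk> \<Longrightarrow> a \<odot>\<^bsub>M\<^esub> x \<in> N"
    and homog_M: "\<And>n. homog M n \<subseteq> carrier M" and homog_X: "\<And>n. homog X n \<subseteq> carrier X"
    and g: "graded_hom R X M g"
    and trivial: "\<And>x. \<lbrakk>x \<in> carrier X; g x \<in> N\<rbrakk> \<Longrightarrow> x = \<zero>\<^bsub>X\<^esub>"
    and span: "\<And>m. m \<in> carrier M \<Longrightarrow> \<exists>k\<in>N. \<exists>x\<in>carrier X. m = k \<oplus>\<^bsub>M\<^esub> g x"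
    and span_homog: "\<And>n m. m \<in> homog M n \<Longrightarrow> \<exists>k\<in>N. \<exists>x\<in>homog X n. m = k \<oplus>\<^bsub>M\<^esub> g x"
  shows "graded_iso R (quotient_module M N) X (inv_into (carrier X) (\<lambda>x. N +>\<^bsub>M\<^esub> g x))"
proof -
  interpret M: left_module R M by (rule M)
  interpret X: left_module R X by (rule X)
  interpret N: abelian_subgroup N M
    by (rule abelian_subgroupI3) (rule N, rule M.abelian_group_axioms)
  interpret g: abelian_group_hom X M g
    using g X.abelian_group_axioms M.abelian_group_axioms
    by (auto simp: graded_hom_def abelian_group_hom_def abelian_group_hom_axioms_def
      group_hom_def group_hom_axioms_def X.a_group M.a_group)
  let ?q = "\<lambda>x. N +>\<^bsub>M\<^esub> g x"
  let ?f = "inv_into (carrier X) ?q"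
  have coset_absorb: "N +>\<^bsub>M\<^esub> (k \<oplus>\<^bsub>M\<^esub> m) = N +>\<^bsub>M\<^esub> m" if "k \<in> N" "m \<in> carrier M" for k m
  proof -
    have "k \<oplus>\<^bsub>M\<^esub> m \<in> N +>\<^bsub>M\<^esub> m"
      using that by (auto simp: a_r_coset_def' )
    then show ?thesis using that N.a_repr_independence' by metis
  qed
  have inj: "inj_on ?q (carrier X)"
  proof (rule inj_onI)
    fix x y assume xy: "x \<in> carrier X" "y \<in> carrier X" "?q x = ?q y"
    then have "g x \<in> N +>\<^bsub>M\<^esub> g y" using N.a_rcos_self[of "g x"] by simp
    then have "g x \<oplus>\<^bsub>M\<^esub> \<ominus>\<^bsub>M\<^esub> g y \<in> N"
      using xy N.a_rcos_module[of "g y" "g x"] by simp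
    then have "g (x \<ominus>\<^bsub>X\<^esub> y) \<in> N" using xy by (simp add: a_minus_def)
    then have "x \<ominus>\<^bsub>X\<^esub> y = \<zero>\<^bsub>X\<^esub>" using xy trivial by simp
    then show "x = y" using xy X.minus_equality[of x "\<ominus>\<^bsub>X\<^esub> y"] by (simp add: a_minus_def)
  qed
  have image: "?q ` carrier X = a_rcosets\<^bsub>M\<^esub> N"
  proof
    show "?q ` carrier X \<subseteq> a_rcosets\<^bsub>M\<^esub> N" by (force simp: A_RCOSETS_def')
    show "a_rcosets\<^bsub>M\<^esub> N \<subseteq> ?q ` carrier X"
    proof
      fix C assume "C \<in> a_rcosets\<^bsub>M\<^esub> N"
      then obtain m where m: "m \<in> carrier M" "C = N +>\<^bsub>M\<^esub> m" by (auto simp: A_RCOSETS_def')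
      from span[OF m(1)] obtain k x where "k \<in> N" "x \<in> carrier X" "m = k \<oplus>\<^bsub>M\<^esub> g x" by auto
      then show "C \<in> ?q ` carrier X" using m by (simp add: coset_absorb)
    qed
  qed
  have image_homog: "?q ` homog X n = (\<lambda>m. N +>\<^bsub>M\<^esub> m) ` homog M n" for n
  proof
    show "?q ` homog X n \<subseteq> (\<lambda>m. N +>\<^bsub>M\<^esub> m) ` homog M n"
    proof -
      have "g ` homog X n \<subseteq> homog M n" using g by (simp add: graded_hom_def)
      then show ?thesis by blast
    qed
    show "(\<lambda>m. N +>\<^bsub>M\<^esub> m) ` homog M n \<subseteq> ?q ` homog X n"
    proof
      fix C assume "C \<in> (\<lambda>m. N +>\<^bsub>M\<^esub> m) ` homog M n"
      then obtain m where m: "m \<in> homog M n" "C = N +>\<^bsub>M\<^esub> m" by auto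
      from span_homog[OF m(1)] obtain k x where "k \<in> N" "x \<in> homog X n" "m = k \<oplus>\<^bsub>M\<^esub> g x" by auto
      moreover then have "x \<in> carrier X" using homog_X by auto
      ultimately show "C \<in> ?q ` homog X n" using m by (simp add: coset_absorb)
    qed
  qed
  have f_q: "?f (?q x) = x" if "x \<in> carrier X" for x
    using inj that by (rule inv_into_f_f)
  have q_add: "?q x <+>\<^bsub>M\<^esub> ?q y = ?q (x \<oplus>\<^bsub>X\<^esub> y)" if "x \<in> carrier X" "y \<in> carrier X" for x y
    using that by (simp add: N.a_rcos_sum)
  have q_smult: "(\<Union>m\<in>?q x. N +>\<^bsub>M\<^esub> (a \<odot>\<^bsub>M\<^esub> m)) = ?q (a \<odot>\<^bsub>X\<^esub> x)"
    if a: "a \<in> carrier R" and x: "x \<in> carrier X" for a x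
  proof -
    have "N +>\<^bsub>M\<^esub> (a \<odot>\<^bsub>M\<^esub> m) = ?q (a \<odot>\<^bsub>X\<^esub> x)" if m: "m \<in> ?q x" for m
    proof -
      obtain k where k: "k \<in> N" "m = k \<oplus>\<^bsub>M\<^esub> g x" using m by (auto simp: a_r_coset_def')
      then have "a \<odot>\<^bsub>M\<^esub> m = a \<odot>\<^bsub>M\<^esub> k \<oplus>\<^bsub>M\<^esub> a \<odot>\<^bsub>M\<^esub> g x"
        using a x by (simp add: M.smult_r_distr)
      moreover have "a \<odot>\<^bsub>M\<^esub> g x = g (a \<odot>\<^bsub>X\<^esub> x)" using g a x by (simp add: graded_hom_def)
      ultimately show ?thesis using a x k N_smult by (simp add: coset_absorb X.smult_closed)
    qed
    moreover have "?q x \<noteq> {}" using x N.a_rcos_self[of "g x"] by auto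
    ultimately show ?thesis by auto
  qed
  have Q: "carrier (quotient_module M N) = ?q ` carrier X"
    "homog (quotient_module M N) n = ?q ` homog X n" for n
    by (simp_all add: quotient_module_def image image_homog)
  have homog_inv: "?f ` ?q ` homog X n = homog X n" for n
  proof -
    have "?f ` ?q ` homog X n = (\<lambda>x. x) ` homog X n"
      unfolding image_image by (rule image_cong) (use homog_X f_q in auto)
    then show ?thesis by simp
  qed
  have "graded_hom R (quotient_module M N) X ?f"
    unfolding graded_hom_def
  proof (intro conjI allI ballI)
    show "?f \<in> hom (add_monoid (quotient_module M N)) (add_monoid X)"
    proof (rule homI)
      fix C assume "C \<in> carrier (add_monoid (quotient_module M N))"
      then show "?f C \<in> carrier (add_monoid X)" using Q(1) f_q by auto
    next
      fix C D assume "C \<in> carrier (add_monoid (quotient_module M N))"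
        "D \<in> carrier (add_monoid (quotient_module M N))"
      then obtain x y where xy: "x \<in> carrier X" "C = ?q x" "y \<in> carrier X" "D = ?q y"
        using Q(1) by auto
      then have "C \<otimes>\<^bsub>add_monoid (quotient_module M N)\<^esub> D = ?q (x \<oplus>\<^bsub>X\<^esub> y)"
        by (simp add: quotient_module_def q_add)
      then show "?f (C \<otimes>\<^bsub>add_monoid (quotient_module M N)\<^esub> D) = ?f C \<otimes>\<^bsub>add_monoid X\<^esub> ?f D"
        using xy by (simp only: f_q X.a_closed) (simp add: f_q)
    qed
  next
    fix a C assume a: "a \<in> carrier R" and "C \<in> carrier (quotient_module M N)"
    then obtain x where x: "x \<in> carrier X" "C = ?q x" using Q(1) by auto
    have "a \<odot>\<^bsub>quotient_module M N\<^esub> C = ?q (a \<odot>\<^bsub>X\<^esub> x)"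
      unfolding x quotient_module_def using a x(1) by (simp add: q_smult)
    then show "?f (a \<odot>\<^bsub>quotient_module M N\<^esub> C) = a \<odot>\<^bsub>X\<^esub> ?f C"
      using a x by (simp only: f_q X.smult_closed)
  next
    fix n show "?f ` homog (quotient_module M N) n \<subseteq> homog X n" by (simp only: Q homog_inv)
  qed
  moreover have "bij_betw ?f (carrier (quotient_module M N)) (carrier X)"
    unfolding Q using inj by (simp add: bij_betw_inv_into inj_on_imp_bij_betw)
  ultimately show ?thesis
    by (simp add: graded_iso_def Q homog_inv)
qed

lemma left_module_shift: "left_module R M \<Longrightarrow> left_module R (shift_module d M)"
  by (simp add: left_module_def left_module_axioms_def shift_module_def abelian_group_def
      abelian_monoid_def abelian_group_axioms_def)

lemma has_filtration_mono:
  "has_filtration R M K \<X> \<Longrightarrow> \<X> \<subseteq> \<Y> \<Longrightarrow> has_filtration R M K \<Y>"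
  unfolding has_filtration_def by (elim ex_forward conj_forward asm_rl) blast+

lemma has_filtration_zero:
  "graded_submodule R M {\<zero>\<^bsub>M\<^esub>} \<Longrightarrow> has_filtration R M {\<zero>\<^bsub>M\<^esub>} \<X>"
  unfolding has_filtration_def by (intro exI[of _ 0] exI[of _ "\<lambda>_. {\<zero>\<^bsub>M\<^esub>}"]) simp

section \<open>A basis of the bipartite algebra\<close>

context finite_bipartite_graph
begin

abbreviation "Q \<equiv> double_quiver B"
abbreviation "S \<equiv> path_algebra (double_quiver B)"
abbreviation "A \<equiv> bip_alg B"
abbreviation "\<kappa> \<equiv> bip_class B"
abbreviation "deg \<equiv> bip_deg B"

lemma verts_Q [simp]: "verts Q = vertices B"
  by (simp add: double_quiver_def)

lemma finite_vertices: "finite (vertices B)"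
  using finite_part0 finite_part1 by (simp add: vertices_def)

lemma finite_arcs: "finite (arcs Q)"
  using finite_edges by (simp add: double_quiver_def)

lemma part1_not_part0: "v \<in> part1 B \<Longrightarrow> v \<notin> part0 B"
  using parts_disjoint by auto

lemma arc_ends:
  assumes "a \<in> arcs Q"
  shows "tail Q a \<in> part0 B \<and> head Q a \<in> part1 B \<or> tail Q a \<in> part1 B \<and> head Q a \<in> part0 B"
  using assms end0_in end1_in by (auto simp: double_quiver_def)

sublocale quiver: wf_digraph "double_quiver B"
  by unfold_locales (use arc_ends in \<open>fastforce simp: vertices_def\<close>)+

lemma ring_S: "ring S"
  by (rule quiver.path_algebra_ring) (simp add: finite_vertices)

lemma carrier_S: "f \<in> carrier S \<longleftrightarrow> supp f \<subseteq> paths Q"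
  by (simp add: path_algebra_def)

lemma S_simps [simp]:
  "f \<otimes>\<^bsub>S\<^esub> g = path_mult Q f g" "f \<oplus>\<^bsub>S\<^esub> g = f + g" "\<zero>\<^bsub>S\<^esub> = 0"
  by (simp_all add: path_algebra_def)

text \<open>
  The paths without a subpath of length two that starts and ends in \<open>part0\<close>. The two sides
  alternate along a path, so every path of length at least three contains such a subpath, and a
  path of length two is one exactly if it starts in \<open>part0\<close>.
\<close>

definition normal_paths :: "('v, 'e \<times> bool) path set" where
  "normal_paths = {p \<in> paths Q. path_length p \<le> 1 \<or> path_length p = 2 \<and> source p \<in> part1 B}"

lemma normal_subset_paths: "normal_paths \<subseteq> paths Q"
  by (auto simp: normal_paths_def)

text \<open>
  Subpaths of normal paths are normal. Read backwards, the paths that are not normal are closed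
  under extension on both sides, hence span an ideal.
\<close>

lemma normal_append:
  assumes "p \<in> paths Q" "q \<in> paths Q" "target Q p = source q" "path_append p q \<in> normal_paths"
  shows "p \<in> normal_paths" "q \<in> normal_paths"
proof -
  show "p \<in> normal_paths" using assms by (auto simp: normal_paths_def)
  have "source q = source p" if "path_length p = 0"
    using that assms(3) by (cases p) (auto simp: path_length_def source_def)
  then show "q \<in> normal_paths" using assms by (auto simp: normal_paths_def)
qed

lemma constant_normal: "i \<in> vertices B \<Longrightarrow> (i, []) \<in> normal_paths"
  by (simp add: normal_paths_def path_length_def)

lemma ideal_non_normal: "ideal {f \<in> carrier S. supp f \<inter> normal_paths = {}} S"
proof -
  interpret S: ring S by (rule ring_S)
  show ?thesis
  proof (rule idealI)
    show "ring S" by (rule ring_S)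
    show "subgroup {f \<in> carrier S. supp f \<inter> normal_paths = {}} (add_monoid S)"
    proof (rule S.add.subgroupI)
      fix f assume f: "f \<in> {f \<in> carrier S. supp f \<inter> normal_paths = {}}"
      then have "\<ominus>\<^bsub>S\<^esub> f = - f"
        by (intro S.minus_equality) (auto simp: carrier_S in_keys_iff)
      with f show "\<ominus>\<^bsub>S\<^esub> f \<in> {f \<in> carrier S. supp f \<inter> normal_paths = {}}"
        by (auto simp: carrier_S in_keys_iff)
    next
      fix f g assume "f \<in> {f \<in> carrier S. supp f \<inter> normal_paths = {}}"
        "g \<in> {f \<in> carrier S. supp f \<inter> normal_paths = {}}"
      then have "supp f \<subseteq> paths Q - normal_paths" "supp g \<subseteq> paths Q - normal_paths"
        by (auto simp: carrier_S)
      then have "supp (f + g) \<subseteq> paths Q - normal_paths" by (rule supp_add)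
      then show "f \<oplus>\<^bsub>S\<^esub> g \<in> {f \<in> carrier S. supp f \<inter> normal_paths = {}}"
        by (auto simp: carrier_S)
    qed (auto intro!: exI[of _ 0] simp: carrier_S)
  next
    fix f g assume f: "f \<in> {f \<in> carrier S. supp f \<inter> normal_paths = {}}" and g: "g \<in> carrier S"
    have "path_mult Q g f \<in> carrier S" "path_mult Q f g \<in> carrier S"
      using f g quiver.path_mult_closed by (simp_all add: carrier_S)
    moreover have "supp (path_mult Q g f) \<inter> normal_paths = {}"
      using supp_path_mult[of Q g f] normal_append(2) f g unfolding carrier_S mem_Collect_eq by blast
    moreover have "supp (path_mult Q f g) \<inter> normal_paths = {}"
      using supp_path_mult[of Q f g] normal_append(1) f g unfolding carrier_S mem_Collect_eq by blast
    ultimately show "g \<otimes>\<^bsub>S\<^esub> f \<in> {f \<in> carrier S. supp f \<inter> normal_paths = {}}"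
      "f \<otimes>\<^bsub>S\<^esub> g \<in> {f \<in> carrier S. supp f \<inter> normal_paths = {}}"
      by simp_all
  qed
qed

text \<open>
  The generators are not normal, which gives one inclusion. Conversely, a path that is not
  normal contains a generator: at its start if it starts in \<open>part0\<close>, and after its first arrow
  otherwise.
\<close>

lemma bip_ideal_eq: "bip_ideal B = {f \<in> carrier S. supp f \<inter> normal_paths = {}}"
proof
  interpret S: ring S by (rule ring_S)
  let ?G = "{single p 1 | p. p \<in> paths Q \<and> path_length p = 2 \<and>
     source p \<in> part0 B \<and> target Q p \<in> part0 B} :: ('v, 'e) path_elt set"
  show "bip_ideal B \<subseteq> {f \<in> carrier S. supp f \<inter> normal_paths = {}}"
    unfolding bip_ideal_def
    by (rule S.genideal_minimal[OF ideal_non_normal])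
      (auto simp: carrier_S normal_paths_def dest: part1_not_part0)
  interpret J: ideal "bip_ideal B" S
    unfolding bip_ideal_def by (rule S.genideal_ideal) (auto simp: carrier_S)
  have G: "single p 1 \<in> bip_ideal B"
    if "p \<in> paths Q" "path_length p = 2" "source p \<in> part0 B" "target Q p \<in> part0 B" for p
    using that unfolding bip_ideal_def genideal_def by blast
  have left: "single (path_append p q) c \<in> bip_ideal B"
    if "single p 1 \<in> bip_ideal B" "q \<in> paths Q" "target Q p = source q" for p q and c :: complex
  proof -
    have "single p 1 \<otimes>\<^bsub>S\<^esub> single q c \<in> bip_ideal B"
      using that by (intro J.I_r_closed) (auto simp: carrier_S split: if_splits)
    then show ?thesis using that by (simp add: path_mult_single)
  qed
  have right: "single (path_append p q) c \<in> bip_ideal B"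
    if "single q c \<in> bip_ideal B" "p \<in> paths Q" "target Q p = source q" for p q and c :: complex
  proof -
    have "single p 1 \<otimes>\<^bsub>S\<^esub> single q c \<in> bip_ideal B"
      using that by (intro J.I_l_closed) (auto simp: carrier_S)
    then show ?thesis using that by (simp add: path_mult_single)
  qed
  (* A path of length at least two from part0 begins with a generator. *)
  have start0: "single (u, a # b # s) c \<in> bip_ideal B"
    if "(u, a # b # s) \<in> paths Q" "u \<in> part0 B" for u a b s and c :: complex
  proof -
    have ab: "a \<in> arcs Q" "b \<in> arcs Q" "tail Q a = u" "tail Q b = head Q a" "(head Q b, s) \<in> paths Q"
      using that by (auto simp: quiver.paths_Cons)
    have "head Q b \<in> part0 B"
      using that(2) ab arc_ends[OF ab(1)] arc_ends[OF ab(2)] by (auto dest: part1_not_part0)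
    with ab that(2) have "single (u, [a, b]) 1 \<in> bip_ideal B"
      by (intro G) (auto simp: quiver.paths_Cons path_length_def source_def vertices_def)
    from left[OF this ab(5), of c] show ?thesis
      by (simp add: source_def path_append_def)
  qed
  have bad: "single p c \<in> bip_ideal B" if "p \<in> paths Q - normal_paths" for p and c :: complex
  proof -
    obtain u s where p: "p = (u, s)" by (cases p)
    have u: "u \<in> part0 B \<or> u \<in> part1 B"
      using that quiver.source_in_verts[of p] by (auto simp: p source_def vertices_def)
    have "path_length p \<ge> 2" "u \<in> part1 B \<Longrightarrow> path_length p \<ge> 3"
      using that by (auto simp: normal_paths_def p source_def)
    show ?thesis
    proof (cases "u \<in> part0 B")
      case True
      obtain a b t where "s = a # b # t"
        using \<open>path_length p \<ge> 2\<close> by (auto simp: p path_length_def numeral_2_eq_2 Suc_le_length_iff)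
      then show ?thesis using start0[of u a b t c] that True by (simp add: p)
    next
      case False
      obtain a b b' t where s: "s = a # b # b' # t"
        using \<open>u \<in> part1 B \<Longrightarrow> path_length p \<ge> 3\<close> False u
        by (auto simp: p path_length_def numeral_3_eq_3 Suc_le_length_iff)
      have path: "a \<in> arcs Q" "tail Q a = u" "(head Q a, b # b' # t) \<in> paths Q"
        using that by (auto simp: p s quiver.paths_Cons)
      then have "head Q a \<in> part0 B" using arc_ends[of a] False by auto
      then have "single (head Q a, b # b' # t) c \<in> bip_ideal B" using path by (intro start0)
      from right[OF this, of "(u, [a])"] path show ?thesis
        using quiver.head_in_verts[of a] False u
        by (auto simp: p s path_append_def source_def quiver.paths_Cons)
    qed
  qed
  show "{f \<in> carrier S. supp f \<inter> normal_paths = {}} \<subseteq> bip_ideal B"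
  proof
    fix f assume "f \<in> {f \<in> carrier S. supp f \<inter> normal_paths = {}}"
    then have "supp f \<subseteq> paths Q - normal_paths" by (auto simp: carrier_S)
    then show "f \<in> bip_ideal B"
    proof (induction f rule: supp_additive_induct)
      case zero
      show ?case using J.zero_closed by simp
    next
      case (add f g)
      then show ?case using J.a_closed[of f g] by simp
    qed (rule bad)
  qed
qed

lemma ideal_J: "ideal (bip_ideal B) S"
  unfolding bip_ideal_eq by (rule ideal_non_normal)

lemma ring_A: "ring A"
  unfolding bip_alg_def by (rule ideal.quotient_is_ring[OF ideal_J])

lemma class_hom: "\<kappa> \<in> ring_hom S A"
proof -
  have "\<kappa> = (\<lambda>f. bip_ideal B +>\<^bsub>S\<^esub> f)" by (rule ext) (simp add: bip_class_def)
  then show ?thesis unfolding bip_alg_def using ideal.rcos_ring_hom[OF ideal_J] by simp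
qed

lemma class_add: "supp f \<subseteq> paths Q \<Longrightarrow> supp g \<subseteq> paths Q \<Longrightarrow> \<kappa> f \<oplus>\<^bsub>A\<^esub> \<kappa> g = \<kappa> (f + g)"
  using ring_hom_add[OF class_hom, of f g] by (simp add: carrier_S)

lemma class_mult:
  "supp f \<subseteq> paths Q \<Longrightarrow> supp g \<subseteq> paths Q \<Longrightarrow> \<kappa> f \<otimes>\<^bsub>A\<^esub> \<kappa> g = \<kappa> (path_mult Q f g)"
  using ring_hom_mult[OF class_hom, of f g] by (simp add: carrier_S)

lemma class_zero: "\<zero>\<^bsub>A\<^esub> = \<kappa> 0"
  using ring_hom_zero[OF class_hom ring_S ring_A] by simp

text \<open>
  The classes of the normal paths are a basis of the algebra: they are independent because no
  nonzero combination of them lies in the ideal, and they generate because all other paths do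
  lie in it.
\<close>

lemma class_eq_iff:
  assumes f: "supp f \<subseteq> paths Q" and g: "supp g \<subseteq> paths Q"
  shows "\<kappa> f = \<kappa> g \<longleftrightarrow> (\<forall>p\<in>normal_paths. coeff f p = coeff g p)"
proof -
  interpret S: ring S by (rule ring_S)
  interpret J: ideal "bip_ideal B" S by (rule ideal_J)
  have "\<ominus>\<^bsub>S\<^esub> g = - g"
    using g by (intro S.minus_equality) (auto simp: carrier_S in_keys_iff)
  then have "f \<oplus>\<^bsub>S\<^esub> \<ominus>\<^bsub>S\<^esub> g = f - g" by simp
  then have "f \<in> bip_ideal B +>\<^bsub>S\<^esub> g \<longleftrightarrow> f - g \<in> bip_ideal B"
    using J.a_rcos_module[of g f] f g by (simp add: carrier_S)
  moreover have "\<kappa> f = \<kappa> g \<longleftrightarrow> f \<in> bip_ideal B +>\<^bsub>S\<^esub> g"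
    using J.a_repr_independence'[of f g] J.a_rcos_self[of f] f g
    by (auto simp: bip_class_def carrier_S)
  moreover have "f - g \<in> carrier S"
    using f g keys_diff[of f g] by (auto simp: carrier_S)
  then have "f - g \<in> bip_ideal B \<longleftrightarrow> (\<forall>p\<in>normal_paths. coeff f p = coeff g p)"
    unfolding bip_ideal_eq supp_disjoint_iff by (simp add: lookup_minus)
  ultimately show ?thesis by blast
qed

lemma class_eqI:
  assumes "supp f \<subseteq> paths Q" "supp g \<subseteq> paths Q" "supp g \<inter> normal_paths = {}"
  shows "\<kappa> (f + g) = \<kappa> f"
  using assms by (simp add: class_eq_iff supp_add supp_disjoint_iff lookup_add)

lemma class_restr_normal: "supp f \<subseteq> paths Q \<Longrightarrow> \<kappa> (restr normal_paths f) = \<kappa> f"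
  by (subst class_eq_iff) (auto simp: supp_restr)

definition path_span :: "('v, 'e \<times> bool) path set \<Rightarrow> ('v, 'e) path_elt set set" where
  "path_span K = \<kappa> ` {f. supp f \<subseteq> K}"

lemma spanI: "supp f \<subseteq> K \<Longrightarrow> \<kappa> f \<in> path_span K"
  by (auto simp: path_span_def)

lemma spanE:
  assumes "x \<in> path_span K"
  obtains f where "supp f \<subseteq> K" "x = \<kappa> f"
  using assms by (auto simp: path_span_def)

lemma span_mono: "K \<subseteq> K' \<Longrightarrow> path_span K \<subseteq> path_span K'"
  by (auto simp: path_span_def)

lemma span_empty: "path_span {} = {\<zero>\<^bsub>A\<^esub>}"
  by (simp add: path_span_def class_zero)

lemma span_restr:
  assumes "supp f \<subseteq> paths Q" "supp f \<inter> normal_paths \<subseteq> K"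
  shows "\<kappa> f \<in> path_span K"
  using assms class_restr_normal spanI[of "restr normal_paths f" K] by (simp add: supp_restr)

lemma carrier_A: "carrier A = path_span normal_paths"
proof -
  have "carrier A = \<kappa> ` carrier S"
    by (auto simp: bip_alg_def FactRing_def A_RCOSETS_def' bip_class_def)
  also have "\<dots> = path_span normal_paths"
    using normal_subset_paths by (auto simp: carrier_S intro!: span_restr elim!: spanE)
  finally show ?thesis .
qed

lemma class_closed: "supp f \<subseteq> paths Q \<Longrightarrow> \<kappa> f \<in> carrier A"
  by (simp add: carrier_A span_restr)

lemma carrier_AE:
  assumes "x \<in> carrier A"
  obtains f where "supp f \<subseteq> paths Q" "x = \<kappa> f"
  using assms normal_subset_paths by (auto simp: carrier_A elim!: spanE)

lemma span_subset_carrier: "K \<subseteq> paths Q \<Longrightarrow> path_span K \<subseteq> carrier A"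
  by (auto elim!: spanE intro!: class_closed)

lemma deg_eq: "deg n = \<kappa> ` {f. supp f \<subseteq> paths Q \<inter> {p. int (path_length p) = n}}"
  unfolding bip_deg_def carrier_S by (rule arg_cong[where f = "image \<kappa>"]) auto

text \<open>
  A homogeneous class has a homogeneous representative and, separately, one supported in \<open>K\<close>. They
  agree on normal paths, so the second one is homogeneous too.
\<close>

lemma deg_inter_span:
  assumes "K \<subseteq> normal_paths"
  shows "deg n \<inter> path_span K = path_span (K \<inter> {p. int (path_length p) = n})"
proof
  show "path_span (K \<inter> {p. int (path_length p) = n}) \<subseteq> deg n \<inter> path_span K"
    using assms normal_subset_paths by (auto simp: deg_eq path_span_def)
  show "deg n \<inter> path_span K \<subseteq> path_span (K \<inter> {p. int (path_length p) = n})"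
  proof
    fix x assume "x \<in> deg n \<inter> path_span K"
    then obtain f g where f: "supp f \<subseteq> paths Q" "supp f \<subseteq> {p. int (path_length p) = n}" "x = \<kappa> f"
      and g: "supp g \<subseteq> K" "x = \<kappa> g"
      by (auto simp: deg_eq elim!: spanE)
    have "supp g \<subseteq> paths Q" using g assms normal_subset_paths by auto
    then have "\<forall>p\<in>normal_paths. coeff f p = coeff g p"
      using f g class_eq_iff by simp
    then have "supp g \<subseteq> supp f" using g assms by (auto simp: in_keys_iff)
    with f g have "supp g \<subseteq> K \<inter> {p. int (path_length p) = n}" by blast
    then show "x \<in> path_span (K \<inter> {p. int (path_length p) = n})" unfolding g by (rule spanI)
  qed
qed

lemma deg_span: "deg n = path_span (normal_paths \<inter> {p. int (path_length p) = n})"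
proof -
  have "deg n \<subseteq> path_span normal_paths"
    by (auto simp: deg_eq intro!: span_restr)
  then show ?thesis using deg_inter_span[of normal_paths n] by auto
qed

lemma graded_span_of_paths:
  fixes M :: "(('v, 'e) path_elt set, 'x) ring_scheme"
  assumes "K \<subseteq> normal_paths" "carrier M = path_span K" "add M = add A" "zero M = zero A"
    and "D = (\<lambda>n. deg n \<inter> path_span K)"
  shows "graded_span M D \<kappa> K (\<lambda>p. int (path_length p))"
proof
  have sub: "supp f \<subseteq> paths Q" if "supp f \<subseteq> K" for f :: "('v, 'e) path_elt"
    using that assms(1) normal_subset_paths by blast
  show "inj_on \<kappa> {f. supp f \<subseteq> K}"
  proof (rule inj_onI, rule poly_mapping_eqI)
    fix f g :: "('v, 'e) path_elt" and p
    assume fg: "f \<in> {f. supp f \<subseteq> K}" "g \<in> {f. supp f \<subseteq> K}" "\<kappa> f = \<kappa> g"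
    then have "\<forall>p\<in>normal_paths. coeff f p = coeff g p"
      using class_eq_iff sub by auto
    moreover have "coeff f p = 0 \<and> coeff g p = 0" if "p \<notin> normal_paths"
      using that fg assms(1) in_keys_iff[of p f] in_keys_iff[of p g] by blast
    ultimately show "coeff f p = coeff g p"
      by (cases "p \<in> normal_paths") auto
  qed
  show "D n = \<kappa> ` {f. supp f \<subseteq> K \<inter> {p. int (path_length p) = n}}" for n
    using assms deg_inter_span by (simp add: path_span_def)
  show "\<kappa> f \<oplus>\<^bsub>M\<^esub> \<kappa> g = \<kappa> (f + g)" if "supp f \<subseteq> K" "supp g \<subseteq> K" for f g
    using that sub assms(3) by (simp add: class_add)
  show "carrier M = \<kappa> ` {f. supp f \<subseteq> K}" using assms(2) by (simp add: path_span_def)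
  show "\<zero>\<^bsub>M\<^esub> = \<kappa> 0" using assms(4) by (simp add: class_zero)
qed

lemma graded_span_A: "graded_span A deg \<kappa> normal_paths (\<lambda>p. int (path_length p))"
proof (rule graded_span_of_paths)
  have "deg n \<subseteq> path_span normal_paths" for n unfolding deg_span by (rule span_mono) simp
  then show "deg = (\<lambda>n. deg n \<inter> path_span normal_paths)" by blast
qed (simp_all add: carrier_A)

lemma deg_mult:
  assumes "a \<in> deg m" "b \<in> deg n"
  shows "a \<otimes>\<^bsub>A\<^esub> b \<in> deg (m + n)"
proof -
  obtain f g where f: "supp f \<subseteq> paths Q" "supp f \<subseteq> {p. int (path_length p) = m}" "a = \<kappa> f"
    and g: "supp g \<subseteq> paths Q" "supp g \<subseteq> {p. int (path_length p) = n}" "b = \<kappa> g"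
    using assms by (auto simp: deg_eq)
  have "supp (path_mult Q f g) \<subseteq> {p. int (path_length p) = m + n}"
    using supp_path_mult[of Q f g] f g by fastforce
  then have "\<kappa> (path_mult Q f g) \<in> deg (m + n)"
    using quiver.path_mult_closed f g unfolding deg_eq by blast
  then show ?thesis using f g by (simp add: class_mult)
qed

lemma graded_ring_A: "graded_ring A deg"
proof (intro graded_ring.intro graded_ring_axioms.intro)
  interpret S: ring S by (rule ring_S)
  show "ring A" by (rule ring_A)
  show "graded_group A deg" by (rule graded_span.is_graded_group[OF graded_span_A])
  have "\<one>\<^bsub>A\<^esub> = \<kappa> (\<Sum>v\<in>vertices B. single (v, []) 1)"
    using ring_hom_one[OF class_hom] by (simp add: path_algebra_def)
  moreover have "supp (\<Sum>v\<in>vertices B. single (v, []) (1::complex))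
      \<subseteq> paths Q \<inter> {p. int (path_length p) = 0}"
    by (rule subset_trans[OF supp_sum]) (auto simp: path_length_def)
  ultimately show "\<one>\<^bsub>A\<^esub> \<in> deg 0" unfolding deg_eq by blast
qed (rule deg_mult)

end

section \<open>Modules spanned by normal paths\<close>

text \<open>
  The modules spanned by normal paths come with two actions: multiplication in the algebra for
  \<open>P\<^sub>i\<close> and its submodules, multiplication by the degree zero part for \<open>L\<^sub>i\<close>. Both have the form
  \<open>\<tau> a \<otimes> x\<close> for a degree preserving ring endomorphism \<open>\<tau>\<close> of the algebra, and this is all that the graded
  module axioms need.
\<close>

locale path_module = finite_bipartite_graph B
  for B :: "('v, 'e) bigraph" +
  fixes M :: "(('v, 'e) path_elt set, ('v, 'e) path_elt set) gmodule"
    and \<tau> :: "('v, 'e) path_elt set \<Rightarrow> ('v, 'e) path_elt set"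
    and K :: "('v, 'e \<times> bool) path set"
  assumes K_normal: "K \<subseteq> finite_bipartite_graph.normal_paths B"
    and carrier_M: "carrier M = finite_bipartite_graph.path_span B K"
    and add_M: "add M = add (bip_alg B)"
    and zero_M: "zero M = zero (bip_alg B)"
    and smult_M: "smult M = (\<lambda>a x. \<tau> a \<otimes>\<^bsub>bip_alg B\<^esub> x)"
    and homog_M: "homog M = (\<lambda>n. bip_deg B n \<inter> finite_bipartite_graph.path_span B K)"
    and twist_hom: "\<tau> \<in> ring_hom (bip_alg B) (bip_alg B)"
    and twist_deg: "a \<in> bip_deg B n \<Longrightarrow> \<tau> a \<in> bip_deg B n"
    and twist_closed: "\<lbrakk>a \<in> carrier (bip_alg B); x \<in> finite_bipartite_graph.path_span B K\<rbrakk>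
      \<Longrightarrow> \<tau> a \<otimes>\<^bsub>bip_alg B\<^esub> x \<in> finite_bipartite_graph.path_span B K"
begin

sublocale basis: graded_span M "homog M" "bip_class B" K "\<lambda>p. int (path_length p)"
  by (rule graded_span_of_paths) (use K_normal carrier_M add_M zero_M homog_M in auto)

lemma is_left_module: "left_module A M"
proof -
  interpret A: ring A by (rule ring_A)
  interpret M: abelian_group M by (rule basis.is_abelian_group)
  have sub: "x \<in> carrier A" if "x \<in> path_span K" for x
    using that K_normal normal_subset_paths span_subset_carrier[of K] by blast
  have \<tau>: "\<tau> a \<in> carrier A" if "a \<in> carrier A" for a
    using that twist_hom ring_hom_closed by metis
  show ?thesis
  proof (intro left_module.intro left_module_axioms.intro)
    show "ring A" "abelian_group M" by (rule ring_A M.abelian_group_axioms)+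
  next
    fix x assume "x \<in> carrier M"
    then show "\<one>\<^bsub>A\<^esub> \<odot>\<^bsub>M\<^esub> x = x"
      using ring_hom_one[OF twist_hom] sub by (simp add: smult_M carrier_M)
  qed (simp_all add: smult_M carrier_M add_M twist_closed sub \<tau> A.l_distr A.r_distr A.m_assoc
      ring_hom_add[OF twist_hom] ring_hom_mult[OF twist_hom])
qed

lemma homog_M_subset: "homog M n \<subseteq> carrier M"
  by (simp add: homog_M carrier_M)

lemma is_graded_module: "graded_module A deg M"
  unfolding graded_module_def
proof (intro conjI allI ballI)
  fix m n a x assume a: "a \<in> deg m" and x: "x \<in> homog M n"
  have "a \<in> carrier A" using a span_mono[of _ normal_paths] by (auto simp: deg_span carrier_A)
  then show "a \<odot>\<^bsub>M\<^esub> x \<in> homog M (m + n)"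
    using a x twist_deg twist_closed deg_mult by (simp add: smult_M homog_M)
qed (rule is_left_module basis.is_graded_group)+

lemma span_graded_submodule:
  assumes "K' \<subseteq> K" and closed: "\<And>a x. \<lbrakk>a \<in> carrier A; x \<in> path_span K'\<rbrakk> \<Longrightarrow> \<tau> a \<otimes>\<^bsub>A\<^esub> x \<in> path_span K'"
  shows "graded_submodule A M (path_span K')"
  unfolding graded_submodule_def
proof (intro conjI allI ballI)
  show "additive_subgroup (path_span K') M"
    unfolding path_span_def by (rule basis.span_subgroup[OF assms(1)])
  show "a \<odot>\<^bsub>M\<^esub> x \<in> path_span K'" if "a \<in> carrier A" "x \<in> path_span K'" for a x
    using that closed by (simp add: smult_M)
  show "hpart M (homog M) n x \<in> path_span K'" if x: "x \<in> path_span K'" for x n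
  proof -
    obtain f where f: "supp f \<subseteq> K'" "x = \<kappa> f" using x by (rule spanE)
    then have "hpart M (homog M) n x = \<kappa> (restr {p. int (path_length p) = n} f)"
      using assms(1) basis.hpart_phi by auto
    then show ?thesis using f by (auto simp: supp_restr intro!: spanI)
  qed
qed

lemma path_module_restrict:
  assumes "K' \<subseteq> K" and closed: "\<And>a x. \<lbrakk>a \<in> carrier A; x \<in> path_span K'\<rbrakk> \<Longrightarrow> \<tau> a \<otimes>\<^bsub>A\<^esub> x \<in> path_span K'"
  shows "path_module B (restrict_module M (path_span K')) \<tau> K'"
proof
  show "K' \<subseteq> normal_paths" using assms(1) K_normal by blast
  show "homog (restrict_module M (path_span K')) = (\<lambda>n. deg n \<inter> path_span K')"
    using span_mono[OF assms(1)] by (auto simp: restrict_module_def homog_M)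
qed (use closed twist_deg in \<open>simp_all add: restrict_module_def carrier_M add_M zero_M smult_M twist_hom\<close>)

lemma zero_graded_submodule: "graded_submodule A M {\<zero>\<^bsub>M\<^esub>}"
proof -
  interpret A: ring A by (rule ring_A)
  have "\<tau> a \<otimes>\<^bsub>A\<^esub> \<zero>\<^bsub>A\<^esub> = \<zero>\<^bsub>A\<^esub>" if "a \<in> carrier A" for a
    using that ring_hom_closed[OF twist_hom] by simp
  then show ?thesis using span_graded_submodule[of "{}"] by (simp add: zero_M span_empty)
qed

end

context finite_bipartite_graph
begin

section \<open>The projective and the simple modules\<close>

abbreviation "constants \<equiv> {p :: ('v, 'e \<times> bool) path. path_length p = 0}"

lemma top_class:
  assumes "supp f \<subseteq> paths Q"
  shows "bip_top B (\<kappa> f) = \<kappa> (restr constants f)"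
proof -
  interpret graded_span A deg \<kappa> normal_paths "\<lambda>p. int (path_length p)" by (rule graded_span_A)
  have "bip_top B (\<kappa> f) = hpart A deg 0 (\<kappa> (restr normal_paths f))"
    using assms by (simp add: bip_top_def class_restr_normal)
  also have "\<dots> = \<kappa> (restr {p. int (path_length p) = 0} (restr normal_paths f))"
    by (rule hpart_phi) (auto simp: supp_restr)
  also have "\<dots> = \<kappa> (restr constants f)"
    using assms by (subst class_eq_iff) (auto simp: supp_restr)
  finally show ?thesis .
qed

text \<open>
  The length of a product is the sum of the lengths, so a constant path arises only from constant
  factors. This makes taking the degree zero part multiplicative.
\<close>

lemma restr_constant_mult:
  "restr constants (path_mult Q f g) = path_mult Q (restr constants f) (restr constants g)"
proof -
  let ?f0 = "restr constants f" and ?f1 = "restr (- constants) f"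
  let ?g0 = "restr constants g" and ?g1 = "restr (- constants) g"
  have *: "path_mult Q f g = path_mult Q ?f0 ?g0 + path_mult Q ?f0 ?g1 + path_mult Q ?f1 g"
    using path_mult_restr_left[of Q f g "constants"] path_mult_restr_right[of Q ?f0 g "constants"]
    by simp
  have "restr constants (path_mult Q ?f0 ?g0) = path_mult Q ?f0 ?g0"
    using supp_path_mult[of Q ?f0 ?g0] by (intro restr_idle) (fastforce simp: supp_restr)
  moreover have "restr constants (path_mult Q ?f0 ?g1) = 0"
    using supp_path_mult[of Q ?f0 ?g1] by (intro restr_eq_0) (fastforce simp: supp_restr)
  moreover have "restr constants (path_mult Q ?f1 g) = 0"
    using supp_path_mult[of Q ?f1 g] by (intro restr_eq_0) (fastforce simp: supp_restr)
  ultimately show ?thesis unfolding * by (simp add: restr_add)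
qed

lemma supp_restr_paths: "supp f \<subseteq> paths Q \<Longrightarrow> supp (restr K f) \<subseteq> paths Q"
  by (auto simp: supp_restr)

lemma top_mult:
  assumes "x \<in> carrier A" "y \<in> carrier A"
  shows "bip_top B (x \<otimes>\<^bsub>A\<^esub> y) = bip_top B x \<otimes>\<^bsub>A\<^esub> bip_top B y"
proof -
  obtain f g where "supp f \<subseteq> paths Q" "x = \<kappa> f" "supp g \<subseteq> paths Q" "y = \<kappa> g"
    using assms by (auto elim!: carrier_AE)
  then show ?thesis
    by (simp add: class_mult top_class quiver.path_mult_closed restr_constant_mult supp_restr_paths)
qed

lemma top_add:
  assumes "x \<in> carrier A" "y \<in> carrier A"
  shows "bip_top B (x \<oplus>\<^bsub>A\<^esub> y) = bip_top B x \<oplus>\<^bsub>A\<^esub> bip_top B y"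
proof -
  obtain f g where "supp f \<subseteq> paths Q" "x = \<kappa> f" "supp g \<subseteq> paths Q" "y = \<kappa> g"
    using assms by (auto elim!: carrier_AE)
  then show ?thesis
    by (simp add: class_add top_class supp_add restr_add supp_restr_paths)
qed

lemma top_deg:
  assumes "x \<in> deg n"
  shows "bip_top B x \<in> deg n"
proof -
  obtain f where "supp f \<subseteq> paths Q \<inter> {p. int (path_length p) = n}" "x = \<kappa> f"
    using assms by (auto simp: deg_eq)
  then show ?thesis by (auto simp: top_class deg_eq supp_restr intro!: imageI)
qed

lemma top_hom: "bip_top B \<in> ring_hom A A"
proof (rule ring_hom_memI)
  fix x assume "x \<in> carrier A"
  then show "bip_top B x \<in> carrier A"
    by (auto elim!: carrier_AE simp: top_class intro!: class_closed supp_restr_paths)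
next
  interpret S: ring S by (rule ring_S)
  have one: "\<one>\<^bsub>S\<^esub> = (\<Sum>v\<in>vertices B. single (v, []) 1)" by (simp add: path_algebra_def)
  have "supp \<one>\<^bsub>S\<^esub> \<subseteq> constants"
    unfolding one by (rule subset_trans[OF supp_sum]) (auto simp: path_length_def)
  then have "bip_top B (\<kappa> \<one>\<^bsub>S\<^esub>) = \<kappa> \<one>\<^bsub>S\<^esub>"
    using S.one_closed by (simp add: top_class carrier_S restr_idle)
  then show "bip_top B \<one>\<^bsub>A\<^esub> = \<one>\<^bsub>A\<^esub>" using ring_hom_one[OF class_hom] by simp
qed (simp_all add: top_mult top_add)

lemma path_mult_vertex: "path_mult Q f (single (i, []) 1) = restr {p. target Q p = i} f"
  using subset_UNIV[of "supp f"]
proof (induction f rule: supp_additive_induct)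
  case (single p c)
  have "path_append p (i, []) = p"
    by (cases p) (simp add: path_append_def source_def)
  then show ?case
    by (intro poly_mapping_eqI) (auto simp: path_mult_single source_def lookup_single when_def)
qed (simp_all add: path_mult_add_left restr_add restr_eq_0)

definition paths_to :: "'v \<Rightarrow> ('v, 'e \<times> bool) path set" where
  "paths_to i = {p \<in> normal_paths. target Q p = i}"

lemma class_mult_idem:
  assumes "i \<in> vertices B" "supp f \<subseteq> paths Q"
  shows "\<kappa> f \<otimes>\<^bsub>A\<^esub> bip_idem B i = \<kappa> (restr {p. target Q p = i} f)"
  using assms unfolding bip_idem_def by (subst class_mult) (simp_all add: path_mult_vertex)

lemma carrier_P:
  assumes "i \<in> vertices B"
  shows "carrier (bip_P B i) = path_span (paths_to i)"
proof
  show "carrier (bip_P B i) \<subseteq> path_span (paths_to i)"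
  proof
    fix x assume "x \<in> carrier (bip_P B i)"
    then obtain a where "a \<in> carrier A" "x = a \<otimes>\<^bsub>A\<^esub> bip_idem B i"
      by (auto simp: bip_P_def Let_def)
    then obtain f where f: "supp f \<subseteq> paths Q" "x = \<kappa> (restr {p. target Q p = i} f)"
      using assms by (auto elim!: carrier_AE simp: class_mult_idem)
    show "x \<in> path_span (paths_to i)"
      unfolding f(2) by (rule span_restr) (use f(1) in \<open>auto simp: supp_restr paths_to_def\<close>)
  qed
  show "path_span (paths_to i) \<subseteq> carrier (bip_P B i)"
  proof
    fix x assume "x \<in> path_span (paths_to i)"
    then obtain f where f: "supp f \<subseteq> paths_to i" "x = \<kappa> f" by (rule spanE)
    then have sub: "supp f \<subseteq> paths Q" "supp f \<subseteq> {p. target Q p = i}"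
      using normal_subset_paths by (auto simp: paths_to_def)
    then have "x = \<kappa> f \<otimes>\<^bsub>A\<^esub> bip_idem B i"
      using assms f by (simp add: class_mult_idem restr_idle)
    then show "x \<in> carrier (bip_P B i)"
      using class_closed[OF sub(1)] by (auto simp: bip_P_def Let_def)
  qed
qed

lemma carrier_L:
  assumes "i \<in> vertices B"
  shows "carrier (bip_L B i) = path_span {(i, [])}"
proof
  show "carrier (bip_L B i) \<subseteq> path_span {(i, [])}"
  proof
    fix x assume "x \<in> carrier (bip_L B i)"
    then obtain f where f: "supp f \<subseteq> paths Q" "supp f \<subseteq> constants" "x = \<kappa> f \<otimes>\<^bsub>A\<^esub> bip_idem B i"
      by (auto simp: bip_L_def Let_def deg_eq)
    have "supp (restr {p. target Q p = i} f) \<subseteq> {(i, [])}"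
      using f(2) by (auto simp: supp_restr path_length_def)
    then show "x \<in> path_span {(i, [])}"
      using assms f by (simp add: class_mult_idem spanI)
  qed
  show "path_span {(i, [])} \<subseteq> carrier (bip_L B i)"
  proof
    fix x assume "x \<in> path_span {(i, [])}"
    then obtain f where f: "supp f \<subseteq> {(i, [])}" "x = \<kappa> f" by (rule spanE)
    then have sub: "supp f \<subseteq> paths Q" "supp f \<subseteq> {p. target Q p = i}" "supp f \<subseteq> constants"
      using assms by (auto simp: path_length_def)
    then have "x = \<kappa> f \<otimes>\<^bsub>A\<^esub> bip_idem B i"
      using assms f by (simp add: class_mult_idem restr_idle)
    moreover have "\<kappa> f \<in> deg 0" using sub by (auto simp: deg_eq)
    ultimately show "x \<in> carrier (bip_L B i)" by (auto simp: bip_L_def Let_def)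
  qed
qed

text \<open>
  Left multiplication prepends paths, and a product that is not normal vanishes in the algebra. So
  only the normal products have to stay in \<open>K\<close>.
\<close>

lemma span_left_closed:
  assumes K: "K \<subseteq> paths Q"
    and closed: "\<And>p q. \<lbrakk>p \<in> paths Q; q \<in> K; target Q p = source q; path_append p q \<in> normal_paths\<rbrakk>
      \<Longrightarrow> path_append p q \<in> K"
    and "a \<in> carrier A" "x \<in> path_span K"
  shows "a \<otimes>\<^bsub>A\<^esub> x \<in> path_span K"
proof -
  obtain f g where f: "supp f \<subseteq> paths Q" "a = \<kappa> f" and g: "supp g \<subseteq> K" "x = \<kappa> g"
    using assms by (auto elim!: carrier_AE spanE)
  have g': "supp g \<subseteq> paths Q" using g K by blast
  have "supp (path_mult Q f g) \<inter> normal_paths \<subseteq> K"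
    using supp_path_mult[of Q f g] f g closed by blast
  then show ?thesis
    using f g g' by (simp add: class_mult span_restr quiver.path_mult_closed)
qed

lemma path_module_P:
  assumes i: "i \<in> vertices B"
  shows "path_module B (bip_P B i) (\<lambda>a. a) (paths_to i)"
proof
  show "paths_to i \<subseteq> normal_paths" by (auto simp: paths_to_def)
  show "a \<otimes>\<^bsub>A\<^esub> x \<in> path_span (paths_to i)" if "a \<in> carrier A" "x \<in> path_span (paths_to i)" for a x
    by (rule span_left_closed[OF _ _ that]) (use normal_subset_paths in \<open>auto simp: paths_to_def target_append\<close>)
  show "(\<lambda>a. a) \<in> ring_hom A A" by (rule ring_hom_memI) auto
  show "homog (bip_P B i) = (\<lambda>n. deg n \<inter> path_span (paths_to i))"
    unfolding carrier_P[OF i, symmetric] by (simp add: bip_P_def Let_def)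
qed (simp_all add: carrier_P[OF i], simp_all add: bip_P_def Let_def)

lemma path_module_L:
  assumes i: "i \<in> vertices B"
  shows "path_module B (bip_L B i) (bip_top B) {(i, [])}"
proof
  show K: "{(i, [])} \<subseteq> normal_paths" using i by (simp add: constant_normal)
  show "bip_top B a \<otimes>\<^bsub>A\<^esub> x \<in> path_span {(i, [])}" if a: "a \<in> carrier A" and x: "x \<in> path_span {(i, [])}" for a x
  proof -
    obtain f where f: "supp f \<subseteq> paths Q" "a = \<kappa> f" using a by (rule carrier_AE)
    obtain g where g: "supp g \<subseteq> {(i, [])}" "x = \<kappa> g" using x by (rule spanE)
    let ?h = "path_mult Q (restr constants f) g"
    have "supp ?h \<subseteq> {(i, [])}"
      using supp_path_mult[of Q "restr constants f" g] g(1)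
      by (fastforce simp: supp_restr path_append_def path_length_def source_def)
    moreover have "supp g \<subseteq> paths Q" using g K normal_subset_paths by blast
    ultimately show ?thesis
      using f g by (simp add: top_class class_mult supp_restr_paths spanI)
  qed
  have "deg n \<inter> path_span {(i, [])} = (if n = 0 then path_span {(i, [])} else {\<zero>\<^bsub>A\<^esub>})" for n
  proof -
    have inter: "{(i, [])} \<inter> {p. int (path_length p) = n} = (if n = 0 then {(i, [])} else {})"
      by (auto simp: path_length_def)
    show ?thesis unfolding deg_inter_span[OF K] inter by (simp add: span_empty)
  qed
  moreover have "homog (bip_L B i) = (\<lambda>n. if n = 0 then carrier (bip_L B i) else {\<zero>\<^bsub>A\<^esub>})"
    by (rule ext) (simp add: bip_L_def Let_def)
  ultimately show "homog (bip_L B i) = (\<lambda>n. deg n \<inter> path_span {(i, [])})"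
    unfolding carrier_L[OF i] by presburger
  show "bip_top B a \<in> deg n" if "a \<in> deg n" for a n using that by (rule top_deg)
qed (simp_all add: carrier_L[OF i] top_hom, simp_all add: bip_L_def Let_def bip_top_def)

end

section \<open>Extending paths by an arc\<close>

lemma source_arc [simp]: "source (v, [a]) = v"
  by (simp add: source_def)

lemma path_length_arc [simp]: "path_length (v, [a]) = 1"
  by (simp add: path_length_def)

lemma coeff_path_mult_arc:
  assumes "supp f \<subseteq> {p. target Q p = v}"
  shows "coeff (path_mult Q f (single (v, [a]) 1)) (path_append p (v, [a])) = coeff f p"
  using assms
proof (induction f rule: supp_additive_induct)
  case (single q c)
  have "path_append q (v, [a]) = path_append p (v, [a]) \<longleftrightarrow> q = p"
    by (cases p; cases q) (auto simp: path_append_def source_def)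
  with single show ?case by (simp add: path_mult_single lookup_single when_def)
qed (simp_all add: path_mult_add_left lookup_add)

text \<open>
  Every extended path is the product of a path in \<open>Y\<close> with the arc, so by additivity right
  multiplication by the arc reaches all functions supported on the extended paths.
\<close>

lemma path_mult_arc_onto:
  assumes "supp h \<subseteq> (\<lambda>p. path_append p (v, [a])) ` Y" "Y \<subseteq> {p. target Q p = v}"
  shows "\<exists>f. supp f \<subseteq> Y \<and> path_mult Q f (single (v, [a]) 1) = h"
  using assms(1)
proof (induction h rule: supp_additive_induct)
  case zero
  show ?case by (intro exI[of _ 0]) simp
next
  case (add h k)
  then obtain f g where "supp f \<subseteq> Y" "path_mult Q f (single (v, [a]) 1) = h"
    "supp g \<subseteq> Y" "path_mult Q g (single (v, [a]) 1) = k" by auto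
  then show ?case by (intro exI[of _ "f + g"]) (simp add: supp_add path_mult_add_left)
next
  case (single q c)
  then obtain p where "p \<in> Y" "q = path_append p (v, [a])" by auto
  then show ?case
    using assms(2) by (intro exI[of _ "single p c"]) (auto simp: path_mult_single)
qed

context finite_bipartite_graph
begin

definition ending_in :: "'e \<times> bool \<Rightarrow> ('v, 'e \<times> bool) path set" where
  "ending_in a = {p \<in> normal_paths. snd p \<noteq> [] \<and> last (snd p) = a}"

abbreviation "std j \<equiv> (if j \<in> part0 B then bip_P B j else bip_L B j)"

text \<open>
  Basis and twist of the standard module at \<open>j\<close>, so that the cases \<open>P\<^sub>j\<close> and \<open>L\<^sub>j\<close> can be treated together.
\<close>

definition std_paths :: "'v \<Rightarrow> ('v, 'e \<times> bool) path set" where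
  "std_paths j = (if j \<in> part0 B then paths_to j else {(j, [])})"

definition std_twist :: "'v \<Rightarrow> ('v, 'e) path_elt set \<Rightarrow> ('v, 'e) path_elt set" where
  "std_twist j = (if j \<in> part0 B then \<lambda>a. a else bip_top B)"

lemma path_module_std:
  "j \<in> vertices B \<Longrightarrow> path_module B (std j) (std_twist j) (std_paths j)"
  by (simp add: std_twist_def std_paths_def path_module_P path_module_L)

lemma target_std_paths: "std_paths j \<subseteq> {p. target Q p = j}"
  by (auto simp: std_paths_def paths_to_def)

lemma std_paths_normal: "j \<in> vertices B \<Longrightarrow> std_paths j \<subseteq> normal_paths"
  by (auto simp: std_paths_def paths_to_def constant_normal)

lemma source_part1:
  assumes "p \<in> paths Q" "path_length p = 1" "target Q p \<in> part0 B"
  shows "source p \<in> part1 B"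
proof -
  obtain u c where p: "p = (u, [c])"
    using assms(2) by (cases p) (auto simp: path_length_def length_Suc_conv)
  with assms arc_ends[of c] show ?thesis
    by (auto simp: quiver.paths_Cons source_def dest: part1_not_part0)
qed

text \<open>
  Here the two kinds of standard modules appear. Extending \<open>p\<close> by an arc from \<open>j\<close> keeps a path normal
  exactly if \<open>p\<close> is constant or an arrow from \<open>part1\<close>. If \<open>j\<close> lies in \<open>part0\<close>, all normal paths ending at
  \<open>j\<close> are of this form; if \<open>j\<close> lies in \<open>part1\<close>, the arrows ending at \<open>j\<close> start in \<open>part0\<close>, and only the
  constant path remains.
\<close>

lemma ending_in_eq:
  assumes a: "a \<in> arcs Q"
  shows "ending_in a = (\<lambda>p. path_append p (tail Q a, [a])) ` std_paths (tail Q a)"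
proof
  have arc: "(tail Q a, [a]) \<in> paths Q"
    using a by (simp add: quiver.paths_Cons flip: verts_Q)
  show "ending_in a \<subseteq> (\<lambda>p. path_append p (tail Q a, [a])) ` std_paths (tail Q a)"
  proof
    fix q assume q: "q \<in> ending_in a"
    define p where "p = (fst q, butlast (snd q))"
    have q_eq: "q = path_append p (tail Q a, [a])"
      using q by (cases q) (auto simp: ending_in_def p_def path_append_def source_def)
    have path: "q \<in> paths Q" "q \<in> normal_paths" using q normal_subset_paths by (auto simp: ending_in_def)
    have "q = (fst q, butlast (snd q) @ [a])"
      using q by (cases q) (auto simp: ending_in_def)
    with path(1) have t: "target Q p = tail Q a"
      unfolding p_def by (metis quiver.target_prefix)
    have p: "p \<in> paths Q"
      using path(1) quiver.paths_append[of p "(tail Q a, [a])"] t by (simp add: q_eq)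
    have "p \<in> normal_paths" using normal_append(1)[OF p arc] t path(2) q_eq by simp
    moreover have "p = (tail Q a, [])" if "tail Q a \<notin> part0 B"
    proof -
      have "path_length p = 0"
      proof (rule ccontr)
        assume "path_length p \<noteq> 0"
        then have len: "path_length p = 1" "source p \<in> part1 B"
          using path(2) by (auto simp: q_eq normal_paths_def)
        obtain u c where p_eq: "p = (u, [c])"
          using len(1) by (cases p) (auto simp: path_length_def length_Suc_conv)
        have "head Q c = tail Q a" "tail Q c = u" "c \<in> arcs Q" 
          using p t by (auto simp: p_eq quiver.paths_Cons)
        then show False
          using len(2) that arc_ends[of c] by (auto simp: p_eq source_def dest: part1_not_part0)
      qed
      then show ?thesis using t by (cases p) (simp add: path_length_def)
    qed
    ultimately have "p \<in> std_paths (tail Q a)"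
      using t by (auto simp: std_paths_def paths_to_def)
    then show "q \<in> (\<lambda>p. path_append p (tail Q a, [a])) ` std_paths (tail Q a)"
      using q_eq by blast
  qed
  show "(\<lambda>p. path_append p (tail Q a, [a])) ` std_paths (tail Q a) \<subseteq> ending_in a"
  proof
    fix q assume "q \<in> (\<lambda>p. path_append p (tail Q a, [a])) ` std_paths (tail Q a)"
    then obtain p where p: "p \<in> std_paths (tail Q a)" and q: "q = path_append p (tail Q a, [a])"
      by blast
    have p_normal: "p \<in> normal_paths" and t: "target Q p = tail Q a"
      using p std_paths_normal[of "tail Q a"] target_std_paths[of "tail Q a"] quiver.tail_in_verts[OF a]
      by auto
    have "path_length p = 0 \<or> path_length p = 1 \<and> source p \<in> part1 B"
    proof (cases "tail Q a \<in> part0 B")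
      case True
      consider "path_length p = 0" | "path_length p = 1" | "path_length p = 2" "source p \<in> part1 B"
        using p_normal by (fastforce simp: normal_paths_def)
      then show ?thesis
      proof cases
        case 2
        then show ?thesis using source_part1[of p] p_normal True t normal_subset_paths by auto
      next
        case 3
        obtain u b c where p_eq: "p = (u, [b, c])"
          using 3(1) by (cases p) (auto simp: path_length_def numeral_2_eq_2 length_Suc_conv)
        have "b \<in> arcs Q" "c \<in> arcs Q" "tail Q b = u" "tail Q c = head Q b" "head Q c = tail Q a"
          using p_normal t normal_subset_paths by (auto simp: p_eq quiver.paths_Cons)
        then have False
          using 3(2) True arc_ends[of b] arc_ends[of c]
          by (auto simp: p_eq source_def dest: part1_not_part0)
        then show ?thesis ..
      qed simp
    next
      case False
      then show ?thesis using p by (simp add: std_paths_def path_length_def)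
    qed
    then have "q \<in> normal_paths"
      using quiver.paths_append[of p "(tail Q a, [a])"] p_normal arc t normal_subset_paths
      by (auto simp: q normal_paths_def)
    then show "q \<in> ending_in a" by (simp add: q ending_in_def path_append_def)
  qed
qed

definition arc_class :: "'e \<times> bool \<Rightarrow> ('v, 'e) path_elt set" where
  "arc_class a = \<kappa> (single (tail Q a, [a]) 1)"

lemma arc_path: "a \<in> arcs Q \<Longrightarrow> (tail Q a, [a]) \<in> paths Q"
  by (simp add: quiver.paths_Cons flip: verts_Q)

lemma class_mult_arc:
  assumes "a \<in> arcs Q" "supp f \<subseteq> paths Q"
  shows "\<kappa> f \<otimes>\<^bsub>A\<^esub> arc_class a = \<kappa> (path_mult Q f (single (tail Q a, [a]) 1))"
  using assms arc_path by (simp add: arc_class_def class_mult)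

lemma supp_mult_arc:
  assumes "a \<in> arcs Q" "supp f \<subseteq> std_paths (tail Q a)"
  shows "supp (path_mult Q f (single (tail Q a, [a]) 1)) \<subseteq> ending_in a"
  using supp_path_mult[of Q f "single (tail Q a, [a]) 1"] assms(2)
  unfolding ending_in_eq[OF assms(1)] by fastforce

text \<open>
  Right multiplication by \<open>a\<close> is a homomorphism on the standard module at the tail of \<open>a\<close>. For \<open>P\<^sub>j\<close>
  this is associativity. For \<open>L\<^sub>j\<close> the product \<open>xa\<close> is a multiple of \<open>a\<close> alone, and a path of positive
  length followed by \<open>a\<close> is not normal; hence an element acts on \<open>xa\<close> through its degree zero part,
  as it does on \<open>L\<^sub>j\<close>.
\<close>

lemma twist_absorbed:
  assumes a: "a \<in> arcs Q" and b: "b \<in> carrier A" and x: "x \<in> path_span (std_paths (tail Q a))"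
  shows "(std_twist (tail Q a) b \<otimes>\<^bsub>A\<^esub> x) \<otimes>\<^bsub>A\<^esub> arc_class a = b \<otimes>\<^bsub>A\<^esub> (x \<otimes>\<^bsub>A\<^esub> arc_class a)"
proof -
  interpret A: ring A by (rule ring_A)
  let ?j = "tail Q a"
  have std_sub: "std_paths ?j \<subseteq> paths Q"
    using std_paths_normal[of ?j] normal_subset_paths quiver.tail_in_verts[OF a] by auto
  have x': "x \<in> carrier A" using x span_subset_carrier[OF std_sub] by blast
  have arc: "arc_class a \<in> carrier A"
    using arc_path[OF a] by (simp add: arc_class_def class_closed)
  show ?thesis
  proof (cases "?j \<in> part0 B")
    case True
    then show ?thesis using b x' arc by (simp add: std_twist_def A.m_assoc)
  next
    case False
    obtain f where f: "supp f \<subseteq> paths Q" "b = \<kappa> f" using b by (rule carrier_AE)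
    obtain g where g: "supp g \<subseteq> std_paths ?j" "x = \<kappa> g" using x by (rule spanE)
    let ?h = "path_mult Q g (single (?j, [a]) 1)"
    have h: "supp ?h \<subseteq> {(?j, [a])}"
      using supp_mult_arc[OF a g(1)] False
      by (auto simp: ending_in_eq[OF a] std_paths_def path_append_def source_def)
    have h': "supp ?h \<subseteq> paths Q" using h arc_path[OF a] by auto
    have x_arc: "x \<otimes>\<^bsub>A\<^esub> arc_class a = \<kappa> ?h"
      using g std_sub by (simp add: class_mult_arc[OF a])
    have "supp (path_mult Q (restr (- constants) f) ?h) \<inter> normal_paths = {}"
    proof -
      have "path_append p (?j, [a]) \<notin> normal_paths"
        if p: "p \<in> paths Q" "path_length p \<noteq> 0" "target Q p = ?j" for p
      proof
        assume n: "path_append p (?j, [a]) \<in> normal_paths"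
        then have "path_append p (?j, [a]) \<in> ending_in a"
          by (simp add: ending_in_def path_append_def)
        then obtain p' where "p' \<in> std_paths ?j" "path_append p (?j, [a]) = path_append p' (?j, [a])"
          by (auto simp: ending_in_eq[OF a])
        then show False
          using False p(2) by (auto simp: std_paths_def path_append_def path_length_def)
      qed
      then show ?thesis
        using supp_path_mult[of Q "restr (- constants) f" ?h] h f(1)
        by (fastforce simp: supp_restr)
    qed
    then have "\<kappa> (path_mult Q (restr constants f) ?h + path_mult Q (restr (- constants) f) ?h)
        = \<kappa> (path_mult Q (restr constants f) ?h)"
      using f h' by (intro class_eqI) (simp_all add: quiver.path_mult_closed supp_restr_paths)
    moreover have "path_mult Q f ?h
        = path_mult Q (restr constants f) ?h + path_mult Q (restr (- constants) f) ?h"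
      by (rule path_mult_restr_left)
    ultimately have "\<kappa> (path_mult Q f ?h) = \<kappa> (path_mult Q (restr constants f) ?h)"
      by simp
    then have "b \<otimes>\<^bsub>A\<^esub> (x \<otimes>\<^bsub>A\<^esub> arc_class a) = bip_top B b \<otimes>\<^bsub>A\<^esub> (x \<otimes>\<^bsub>A\<^esub> arc_class a)"
      using f h' by (simp add: x_arc class_mult top_class supp_restr_paths)
    then show ?thesis
      using False b x' arc ring_hom_closed[OF top_hom b] by (simp add: std_twist_def A.m_assoc)
  qed
qed


section \<open>The kernel of the projection onto the simple module\<close>

definition arcs_to :: "'v \<Rightarrow> ('e \<times> bool) set" where
  "arcs_to i = {a \<in> arcs Q. head Q a = i}"

lemma ending_in_paths_to: "a \<in> arcs_to i \<Longrightarrow> ending_in a \<subseteq> paths_to i"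
  by (auto simp: arcs_to_def ending_in_def paths_to_def target_eq)

lemma nonconstant_paths_to:
  "paths_to i - constants = (\<Union>a\<in>arcs_to i. ending_in a)"
proof
  show "(\<Union>a\<in>arcs_to i. ending_in a) \<subseteq> paths_to i - constants"
    using ending_in_paths_to by (fastforce simp: ending_in_def path_length_def)
  show "paths_to i - constants \<subseteq> (\<Union>a\<in>arcs_to i. ending_in a)"
  proof
    fix p assume p: "p \<in> paths_to i - constants"
    then have ne: "snd p \<noteq> []" by (auto simp: path_length_def)
    obtain w where "quiver.awalk (fst p) (snd p) w"
      using p normal_subset_paths by (cases p) (auto simp: paths_to_def paths_def)
    then have "set (snd p) \<subseteq> arcs Q" by (simp add: pre_digraph.awalk_def)
    then have "last (snd p) \<in> arcs Q" using ne by auto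
    with ne p show "p \<in> (\<Union>a\<in>arcs_to i. ending_in a)"
      by (auto simp: arcs_to_def ending_in_def paths_to_def target_eq)
  qed
qed

lemma span_ending_in_closed:
  assumes "U \<subseteq> arcs Q" "b \<in> carrier A" "x \<in> path_span (\<Union>a\<in>U. ending_in a)"
  shows "b \<otimes>\<^bsub>A\<^esub> x \<in> path_span (\<Union>a\<in>U. ending_in a)"
  by (rule span_left_closed[OF _ _ assms(2,3)])
    (use normal_subset_paths in \<open>auto simp: ending_in_def path_append_def\<close>)

lemma kernel_top:
  assumes i: "i \<in> vertices B"
  shows "a_kernel (bip_P B i) (bip_L B i) (bip_top B) = path_span (paths_to i - constants)"
proof -
  interpret P: path_module B "bip_P B i" "\<lambda>a. a" "paths_to i" by (rule path_module_P[OF i])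
  have top: "bip_top B (\<kappa> f) = \<zero>\<^bsub>A\<^esub> \<longleftrightarrow> supp f \<inter> constants = {}" if f: "supp f \<subseteq> paths_to i" for f
  proof -
    have "supp f \<subseteq> paths Q" using f P.K_normal normal_subset_paths by blast
    then have "bip_top B (\<kappa> f) = \<kappa> (restr constants f)" by (rule top_class)
    then have "bip_top B (\<kappa> f) = \<zero>\<^bsub>A\<^esub> \<longleftrightarrow> restr constants f = 0"
      using P.basis.phi_eq_0_iff[of "restr constants f"] f by (auto simp: supp_restr P.zero_M)
    also have "\<dots> \<longleftrightarrow> supp f \<inter> constants = {}"
      by (metis keys_eq_empty supp_restr)
    finally show ?thesis .
  qed
  have "\<zero>\<^bsub>bip_L B i\<^esub> = \<zero>\<^bsub>A\<^esub>" by (simp add: bip_L_def Let_def)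
  then have "a_kernel (bip_P B i) (bip_L B i) (bip_top B) =
      {x \<in> path_span (paths_to i). bip_top B x = \<zero>\<^bsub>A\<^esub>}"
    by (simp add: a_kernel_def' P.carrier_M)
  also have "\<dots> = path_span (paths_to i - constants)"
    using top by (fastforce simp: path_span_def)
  finally show ?thesis .
qed

text \<open>
  Each new arrow \<open>a\<close> contributes the paths ending in \<open>a\<close>. They span a complement of what was there before,
  and right multiplication by \<open>a\<close> embeds the standard module at the tail of \<open>a\<close> as this complement.
\<close>

lemma filtration_step:
  assumes i: "i \<in> vertices B" and U: "U \<subseteq> arcs_to i" and a: "a \<in> arcs_to i" "a \<notin> U"
  shows "iso_up_to_shift A
    (quotient_module (restrict_module (bip_P B i) (path_span (\<Union>c\<in>insert a U. ending_in c)))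
      (path_span (\<Union>c\<in>U. ending_in c)))
    (std (tail Q a))"
proof -
  interpret A: ring A by (rule ring_A)
  let ?j = "tail Q a"
  define N where "N = (\<Union>c\<in>U. ending_in c)"
  define K where "K = (\<Union>c\<in>insert a U. ending_in c)"
  define M where "M = restrict_module (bip_P B i) (path_span K)"
  \<comment> \<open>Multiplication by an arrow raises degrees by one, so degree \<open>n\<close> of \<open>X\<close> is degree \<open>n - 1\<close>.\<close>
  define X where "X = shift_module (- 1) (std ?j)"
  let ?g = "\<lambda>x. x \<otimes>\<^bsub>A\<^esub> arc_class a"
  have a_arc: "a \<in> arcs Q" and U_arcs: "insert a U \<subseteq> arcs Q" using a U by (auto simp: arcs_to_def)
  then have j: "?j \<in> vertices B" using quiver.tail_in_verts by simp
  interpret P: path_module B "bip_P B i" "\<lambda>a. a" "paths_to i" by (rule path_module_P[OF i])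
  have "K \<subseteq> paths_to i" unfolding K_def using ending_in_paths_to a U by blast
  then interpret M: path_module B M "\<lambda>a. a" K
    unfolding M_def
    by (rule P.path_module_restrict) (unfold K_def, rule span_ending_in_closed[OF U_arcs])
  interpret V: path_module B "std ?j" "std_twist ?j" "std_paths ?j" by (rule path_module_std[OF j])
  have N_K: "N \<subseteq> K" by (auto simp: N_def K_def)
  have K_eq: "K = N \<union> ending_in a" by (auto simp: N_def K_def)
  have N_ending: "N \<inter> ending_in a = {}" using a(2) by (auto simp: ending_in_def N_def)
  have std_sub: "std_paths ?j \<subseteq> paths Q" using V.K_normal normal_subset_paths by blast
  have ending_sub: "ending_in a \<subseteq> normal_paths" by (auto simp: ending_in_def)
  have arc: "arc_class a \<in> carrier A"
    using arc_path[OF a_arc] by (simp add: arc_class_def class_closed)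
  have V_sub: "x \<in> carrier A" if "x \<in> path_span (std_paths ?j)" for x
    using that span_subset_carrier[OF std_sub] by blast
  have g_K: "?g x \<in> path_span K" if x: "x \<in> path_span (std_paths ?j)" for x
  proof -
    obtain f where f: "supp f \<subseteq> std_paths ?j" "x = \<kappa> f" using x by (rule spanE)
    then have "?g x = \<kappa> (path_mult Q f (single (?j, [a]) 1))"
      using std_sub by (subst f(2), subst class_mult_arc[OF a_arc]) auto
    then show ?thesis using supp_mult_arc[OF a_arc f(1)] K_eq by (auto intro!: spanI)
  qed
  have arc_deg: "arc_class a \<in> deg 1"
    using arc_path[OF a_arc] by (auto simp: deg_eq arc_class_def path_length_def intro!: imageI)
  have carrier_X: "carrier X = path_span (std_paths ?j)"
    using V.carrier_M by (simp add: X_def shift_module_def)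
  have homog_X: "homog X n = deg (n - 1) \<inter> path_span (std_paths ?j)" for n
    using V.homog_M by (simp add: X_def shift_module_def)
  have zero_X: "\<zero>\<^bsub>X\<^esub> = \<zero>\<^bsub>A\<^esub>" using V.zero_M by (simp add: X_def shift_module_def)
  have add_X: "x \<oplus>\<^bsub>X\<^esub> y = x \<oplus>\<^bsub>A\<^esub> y" for x y using V.add_M by (simp add: X_def shift_module_def)
  have smult_X: "b \<odot>\<^bsub>X\<^esub> x = std_twist ?j b \<otimes>\<^bsub>A\<^esub> x" for b x
    using V.smult_M by (simp add: X_def shift_module_def)
  have "graded_iso A (quotient_module M (path_span N)) X
      (inv_into (carrier X) (\<lambda>x. path_span N +>\<^bsub>M\<^esub> ?g x))"
  proof (rule quotient_by_complement)
    show "left_module A M" by (rule M.is_left_module)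
    show "left_module A X" unfolding X_def by (rule left_module_shift[OF V.is_left_module])
    show "additive_subgroup (path_span N) M"
      using M.basis.span_subgroup[OF N_K] by (simp add: path_span_def)
    show "b \<odot>\<^bsub>M\<^esub> x \<in> path_span N" if "b \<in> carrier A" "x \<in> path_span N" for b x
      using that U_arcs by (simp add: M.smult_M N_def span_ending_in_closed)
    show "homog M n \<subseteq> carrier M" for n by (rule M.homog_M_subset)
    show "homog X n \<subseteq> carrier X" for n by (simp add: homog_X carrier_X)
    show "graded_hom A X M ?g"
      unfolding graded_hom_def
    proof (intro conjI ballI allI)
      show "?g \<in> hom (add_monoid X) (add_monoid M)"
        by (rule homI) (simp_all add: carrier_X M.carrier_M M.add_M g_K add_X V_sub arc A.l_distr)
      show "?g (b \<odot>\<^bsub>X\<^esub> x) = b \<odot>\<^bsub>M\<^esub> ?g x" if "b \<in> carrier A" "x \<in> carrier X" for b x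
        using that twist_absorbed[OF a_arc] by (simp add: smult_X M.smult_M carrier_X)
      show "?g ` homog X n \<subseteq> homog M n" for n
        using deg_mult[OF _ arc_deg, of _ "n - 1"] g_K by (auto simp: homog_X M.homog_M)
    qed
    show "x = \<zero>\<^bsub>X\<^esub>" if x: "x \<in> carrier X" and g: "?g x \<in> path_span N" for x
    proof -
      obtain f where f: "supp f \<subseteq> std_paths ?j" "x = \<kappa> f"
        using x unfolding carrier_X by (rule spanE)
      define h where "h = path_mult Q f (single (?j, [a]) 1)"
      obtain k where k: "supp k \<subseteq> N" "?g x = \<kappa> k" using g by (rule spanE)
      have h: "supp h \<subseteq> ending_in a" unfolding h_def by (rule supp_mult_arc[OF a_arc f(1)])
      have "\<kappa> h = \<kappa> k" using f k std_sub by (simp add: class_mult_arc[OF a_arc] h_def)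
      moreover have "supp h \<subseteq> K" "supp k \<subseteq> K" using h k(1) K_eq by blast+
      ultimately have "h = k" using M.basis.phi_eq_iff[of h k] by simp
      then have "supp h \<subseteq> N \<inter> ending_in a" using h k(1) by simp
      then have "h = 0" unfolding N_ending by simp
      moreover have "coeff f p = coeff h (path_append p (?j, [a]))" for p
        using f(1) target_std_paths[of ?j] unfolding h_def by (subst coeff_path_mult_arc) auto
      ultimately have "f = 0" by (intro poly_mapping_eqI) simp
      then show ?thesis using f by (simp add: zero_X class_zero)
    qed
    \<comment> \<open>\<open>Y\<close> is the whole basis of \<open>X\<close> for the carriers, and one degree of it for the homogeneous parts.\<close>
    have split: "\<exists>k\<in>path_span N. \<exists>x\<in>path_span Y. \<kappa> h = k \<oplus>\<^bsub>M\<^esub> ?g x"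
      if h: "supp h \<subseteq> K" and Y: "Y \<subseteq> std_paths ?j"
        and hY: "supp (restr (ending_in a) h) \<subseteq> (\<lambda>p. path_append p (?j, [a])) ` Y" for h Y
    proof -
      have "\<exists>f. supp f \<subseteq> Y \<and> path_mult Q f (single (?j, [a]) 1) = restr (ending_in a) h"
        using hY Y target_std_paths[of ?j] by (intro path_mult_arc_onto) blast+
      then obtain f where f: "supp f \<subseteq> Y"
        "path_mult Q f (single (?j, [a]) 1) = restr (ending_in a) h" by blast
      have "\<kappa> f \<in> path_span Y" using f(1) by (rule spanI)
      moreover have "\<kappa> (restr N h) \<in> path_span N" by (rule spanI) (simp add: supp_restr)
      moreover have "\<kappa> h = \<kappa> (restr N h) \<oplus>\<^bsub>M\<^esub> ?g (\<kappa> f)"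
      proof -
        have h_eq: "h = restr N h + restr (ending_in a) h"
        proof (rule poly_mapping_eqI)
          fix p
          have "coeff h p = 0" if "p \<notin> N" "p \<notin> ending_in a"
            using that h in_keys_iff[of p h] K_eq by blast
          moreover have "p \<notin> N \<or> p \<notin> ending_in a" using N_ending by blast
          ultimately show "coeff h p = coeff (restr N h + restr (ending_in a) h) p"
            by (auto simp: lookup_add)
        qed
        have image: "?g (\<kappa> f) = \<kappa> (restr (ending_in a) h)"
          using f Y std_sub by (subst class_mult_arc[OF a_arc]) auto
        have "supp (restr N h) \<subseteq> K" "supp (restr (ending_in a) h) \<subseteq> K"
          using h N_K by (auto simp: supp_restr)
        then have sum: "\<kappa> (restr N h) \<oplus>\<^bsub>M\<^esub> \<kappa> (restr (ending_in a) h) =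
            \<kappa> (restr N h + restr (ending_in a) h)"
          by (rule M.basis.add_eq)
        show ?thesis unfolding image sum by (rule arg_cong[OF h_eq])
      qed
      ultimately show ?thesis by blast
    qed
    show "\<exists>k\<in>path_span N. \<exists>x\<in>carrier X. m = k \<oplus>\<^bsub>M\<^esub> ?g x" if m: "m \<in> carrier M" for m
    proof -
      obtain h where h: "supp h \<subseteq> K" "m = \<kappa> h" using m unfolding M.carrier_M by (rule spanE)
      show ?thesis unfolding h(2) carrier_X
        by (rule split[OF h(1)]) (simp_all add: supp_restr ending_in_eq[OF a_arc])
    qed
    show "\<exists>k\<in>path_span N. \<exists>x\<in>homog X n. m = k \<oplus>\<^bsub>M\<^esub> ?g x" if m: "m \<in> homog M n" for m n
    proof -
      let ?Y = "std_paths ?j \<inter> {p. int (path_length p) = n - 1}"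
      have "m \<in> path_span (K \<inter> {p. int (path_length p) = n})"
        using m by (simp add: M.homog_M deg_inter_span[OF M.K_normal])
      then obtain h where h: "supp h \<subseteq> K \<inter> {p. int (path_length p) = n}" "m = \<kappa> h" by (rule spanE)
      have "supp (restr (ending_in a) h) \<subseteq> ending_in a \<inter> {p. int (path_length p) = n}"
        using h by (auto simp: supp_restr)
      also have "\<dots> \<subseteq> (\<lambda>p. path_append p (?j, [a])) ` ?Y"
        unfolding ending_in_eq[OF a_arc] by auto
      finally have "\<exists>k\<in>path_span N. \<exists>x\<in>path_span ?Y. m = k \<oplus>\<^bsub>M\<^esub> ?g x"
        unfolding h(2) using h(1) by (intro split) auto
      then show ?thesis by (simp add: homog_X deg_inter_span[OF V.K_normal])
    qed
  qed
  then show ?thesis unfolding iso_up_to_shift_def M_def K_def N_def X_def by blast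
qed

lemma filtration_kernel_top:
  assumes i: "i \<in> vertices B"
  shows "has_filtration A (bip_P B i) (a_kernel (bip_P B i) (bip_L B i) (bip_top B))
    (std ` tail Q ` arcs_to i)"
proof -
  interpret P: path_module B "bip_P B i" "\<lambda>a. a" "paths_to i" by (rule path_module_P[OF i])
  have "finite (arcs_to i)" using finite_arcs by (simp add: arcs_to_def)
  then obtain as where as: "set as = arcs_to i" "distinct as"
    using finite_distinct_list by blast
  define F where "F k = path_span (\<Union>a\<in>set (take k as). ending_in a)" for k
  have take: "set (take k as) \<subseteq> arcs_to i" for k using as(1) set_take_subset by metis
  show ?thesis
    unfolding has_filtration_def
  proof (intro exI[of _ "length as"] exI[of _ F] conjI allI impI)
    show "F 0 = {\<zero>\<^bsub>bip_P B i\<^esub>}" by (simp add: F_def span_empty P.zero_M)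
    show "F (length as) = a_kernel (bip_P B i) (bip_L B i) (bip_top B)"
      by (simp add: F_def as(1) kernel_top[OF i] nonconstant_paths_to)
    show "graded_submodule A (bip_P B i) (F k)" for k
      unfolding F_def
    proof (rule P.span_graded_submodule)
      show "(\<Union>a\<in>set (take k as). ending_in a) \<subseteq> paths_to i"
        using ending_in_paths_to take by blast
      have "set (take k as) \<subseteq> arcs Q" using take by (auto simp: arcs_to_def)
      then show "b \<otimes>\<^bsub>A\<^esub> x \<in> path_span (\<Union>a\<in>set (take k as). ending_in a)"
        if "b \<in> carrier A" "x \<in> path_span (\<Union>a\<in>set (take k as). ending_in a)" for b x
        using that by (rule span_ending_in_closed)
    qed
    fix k assume k: "k < length as"
    have Suc: "set (take (Suc k) as) = insert (as ! k) (set (take k as))"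
      using k by (simp add: take_Suc_conv_app_nth)
    have "distinct (take k as @ [as ! k])"
      using distinct_take[OF as(2), of "Suc k"] by (simp only: take_Suc_conv_app_nth[OF k])
    then have new: "as ! k \<notin> set (take k as)" by simp
    have ak: "as ! k \<in> arcs_to i" using nth_mem[OF k] as(1) by simp
    show "F k \<subseteq> F (Suc k)" unfolding F_def Suc by (rule span_mono) blast
    show "\<exists>X\<in>std ` tail Q ` arcs_to i.
        iso_up_to_shift A (quotient_module (restrict_module (bip_P B i) (F (Suc k))) (F k)) X"
    proof
      show "iso_up_to_shift A (quotient_module (restrict_module (bip_P B i) (F (Suc k))) (F k))
          (std (tail Q (as ! k)))"
        unfolding F_def Suc by (rule filtration_step[OF i take ak new])
      show "std (tail Q (as ! k)) \<in> std ` tail Q ` arcs_to i" using ak by blast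
    qed
  qed
qed

lemma graded_epi_top:
  assumes i: "i \<in> vertices B"
  shows "graded_epi A (bip_P B i) (bip_L B i) (bip_top B)"
proof -
  interpret P: path_module B "bip_P B i" "\<lambda>a. a" "paths_to i" by (rule path_module_P[OF i])
  interpret L: path_module B "bip_L B i" "bip_top B" "{(i, [])}" by (rule path_module_L[OF i])
  have P_sub: "x \<in> carrier A" if "x \<in> path_span (paths_to i)" for x
    using that span_mono[OF P.K_normal] by (auto simp: carrier_A)
  have const: "paths_to i \<inter> constants = {(i, [])}"
    using i by (auto simp: paths_to_def path_length_def constant_normal)
  have image: "bip_top B ` path_span (paths_to i) = path_span {(i, [])}"
  proof
    have sub: "supp f \<subseteq> paths Q" if "supp f \<subseteq> paths_to i" for f :: "('v, 'e) path_elt"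
      using that P.K_normal normal_subset_paths by blast
    show "bip_top B ` path_span (paths_to i) \<subseteq> path_span {(i, [])}"
    proof
      fix y assume "y \<in> bip_top B ` path_span (paths_to i)"
      then obtain f where f: "supp f \<subseteq> paths_to i" "y = bip_top B (\<kappa> f)" by (auto elim!: spanE)
      have "supp (restr constants f) \<subseteq> {(i, [])}" using f(1) const by (auto simp: supp_restr)
      then show "y \<in> path_span {(i, [])}" using f sub by (simp add: top_class spanI)
    qed
    show "path_span {(i, [])} \<subseteq> bip_top B ` path_span (paths_to i)"
    proof
      fix y assume "y \<in> path_span {(i, [])}"
      then obtain f where f: "supp f \<subseteq> {(i, [])}" "y = \<kappa> f" by (rule spanE)
      then have f': "supp f \<subseteq> paths_to i" "supp f \<subseteq> constants" using const by blast+
      then have "y = bip_top B (\<kappa> f)" using f sub by (simp add: top_class restr_idle)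
      then show "y \<in> bip_top B ` path_span (paths_to i)" using spanI[OF f'(1)] by blast
    qed
  qed
  have "graded_hom A (bip_P B i) (bip_L B i) (bip_top B)"
    unfolding graded_hom_def
  proof (intro conjI ballI allI)
    show "bip_top B \<in> hom (add_monoid (bip_P B i)) (add_monoid (bip_L B i))"
      using image by (intro homI)
        (auto simp: P.carrier_M L.carrier_M P.add_M L.add_M top_add P_sub)
    show "bip_top B (a \<odot>\<^bsub>bip_P B i\<^esub> x) = a \<odot>\<^bsub>bip_L B i\<^esub> bip_top B x"
      if "a \<in> carrier A" "x \<in> carrier (bip_P B i)" for a x
      using that by (simp add: P.carrier_M P.smult_M L.smult_M top_mult P_sub)
    show "bip_top B ` homog (bip_P B i) n \<subseteq> homog (bip_L B i) n" for n
      using image top_deg by (auto simp: P.homog_M L.homog_M)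
  qed
  then show ?thesis by (simp add: graded_epi_def P.carrier_M L.carrier_M image)
qed

end

lemma graded_epi_id: "graded_epi R M M id"
  by (auto simp: graded_epi_def graded_hom_def hom_def)

lemma a_kernel_id: "\<zero>\<^bsub>M\<^esub> \<in> carrier M \<Longrightarrow> a_kernel M M id = {\<zero>\<^bsub>M\<^esub>}"
  by (auto simp: a_kernel_def')

theorem proposition2p5:
  fixes B :: "('v, 'e) bigraph"
  assumes "finite_bipartite_graph B"
  shows "standard_modules (bip_alg B) (bip_deg B) (vertices B)
           (\<lambda>i j. i \<in> part1 B \<and> j \<in> part0 B)
           (bip_L B) (bip_P B)
           (\<lambda>i. if i \<in> part0 B then bip_P B i else bip_L B i)
           (\<lambda>i. if i \<in> part0 B then id else bip_top B)
           (\<lambda>i. if i \<in> part0 B then bip_top B else id)"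
proof -
  interpret finite_bipartite_graph B by (rule assms)
  have P: "graded_module A deg (bip_P B i)" if "i \<in> vertices B" for i
    using path_module_P[OF that] by (rule path_module.is_graded_module)
  have L: "graded_module A deg (bip_L B i)" if "i \<in> vertices B" for i
    using path_module_L[OF that] by (rule path_module.is_graded_module)
  have trivial: "has_filtration A M (a_kernel M M id) \<X>"
    if M: "path_module B M \<tau> K" for M \<tau> K and \<X> :: "(('v, 'e) path_elt set, ('v, 'e) path_elt set) gmodule set"
  proof -
    interpret M: path_module B M \<tau> K by (rule M)
    interpret abelian_group M by (rule M.basis.is_abelian_group)
    show ?thesis
      using has_filtration_zero[OF M.zero_graded_submodule] by (simp add: a_kernel_id)
  qed
  have tails: "tail Q ` arcs_to i \<subseteq> part1 B" if "i \<in> part0 B" for i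
    using that arc_ends by (fastforce simp: arcs_to_def dest: part1_not_part0)
  have tails': "tail Q ` arcs_to i \<subseteq> part0 B" if "i \<notin> part0 B" for i
    using that arc_ends by (fastforce simp: arcs_to_def)
  show ?thesis
  proof (intro standard_modules.intro standard_modules_axioms.intro)
    show "graded_ring A deg" by (rule graded_ring_A)
    show "irreflp_on (vertices B) (\<lambda>i j. i \<in> part1 B \<and> j \<in> part0 B)"
      by (auto simp: irreflp_on_def dest: part1_not_part0)
    show "transp_on (vertices B) (\<lambda>i j. i \<in> part1 B \<and> j \<in> part0 B)"
      by (auto simp: transp_on_def)
  next
    fix i assume i: "i \<in> vertices B"
    show "graded_module A deg (bip_L B i)" "graded_module A deg (bip_P B i)"
      "graded_module A deg (if i \<in> part0 B then bip_P B i else bip_L B i)"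
      using P L i by simp_all
    show "graded_epi A (bip_P B i) (if i \<in> part0 B then bip_P B i else bip_L B i)
        (if i \<in> part0 B then id else bip_top B)"
      "graded_epi A (if i \<in> part0 B then bip_P B i else bip_L B i) (bip_L B i)
        (if i \<in> part0 B then bip_top B else id)"
      using graded_epi_top[OF i] by (simp_all add: graded_epi_id)
    show "has_filtration A (if i \<in> part0 B then bip_P B i else bip_L B i)
        (a_kernel (if i \<in> part0 B then bip_P B i else bip_L B i) (bip_L B i)
          (if i \<in> part0 B then bip_top B else id))
        (bip_L B ` {j \<in> vertices B. j \<in> part1 B \<and> i \<in> part0 B})"
    proof (cases "i \<in> part0 B")
      case True
      have "std ` tail Q ` arcs_to i \<subseteq> bip_L B ` {j \<in> vertices B. j \<in> part1 B \<and> i \<in> part0 B}"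
        using tails[OF True] True by (auto simp: vertices_def dest: part1_not_part0)
      with filtration_kernel_top[OF i] True show ?thesis
        by (simp add: has_filtration_mono)
    qed (simp add: trivial[OF path_module_L[OF i]])
    show "has_filtration A (bip_P B i)
        (a_kernel (bip_P B i) (if i \<in> part0 B then bip_P B i else bip_L B i)
          (if i \<in> part0 B then id else bip_top B))
        ((\<lambda>i. if i \<in> part0 B then bip_P B i else bip_L B i) `
          {k \<in> vertices B. i \<in> part1 B \<and> k \<in> part0 B})"
    proof (cases "i \<in> part0 B")
      case False
      then have "i \<in> part1 B" using i by (auto simp: vertices_def)
      then have "std ` tail Q ` arcs_to i \<subseteq> std ` {k \<in> vertices B. i \<in> part1 B \<and> k \<in> part0 B}"
        using tails'[OF False] by (intro image_mono) (auto simp: vertices_def)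
      with filtration_kernel_top[OF i] False show ?thesis
        by (simp add: has_filtration_mono)
    qed (simp add: trivial[OF path_module_P[OF i]])
  qed
qed

end
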